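(* The functor $\Gamma\colon\mathrm{GlobCard}\to\mathrm{OGraph}$ is an equivalence of categories between the category of globular cardinals and the category of ordinal graphs, with equivalence inverse $\Gamma'\colon\mathrm{OGraph}\to\mathrm{GlobCard}$.
   Context: Globular cardinals. A globular set $X$ is a sequence of sets $X_n$ ($n\ge0$) with maps $s_n,t_n\colon X_{n+1}\to X_n$ such that $s_ns_{n+1}=s_nt_{n+1}$ and $t_ns_{n+1}=t_nt_{n+1}$; morphisms are sequences of maps commuting with sources and targets. $X$ has dimension $n$ if $X_m=\emptyset$ for all $m>n$; the empty globular set has dimension $-1$. The relation $\blacktriangleleft$ on the set of all elements (vertices) of $X$ is the reflexive-transitive closure of: $x\prec y$ when $x=s(y)$ or $y=t(x)$. A globular cardinal is a globular set with finitely many vertices in total for which $\blacktriangleleft$ is a linear order. $\mathrm{GlobCard}$ is the full subcategory of globular sets on the globular cardinals. A morphism $f$ of globular cardinals sends consecutive elements of $X_0$ to consecutive elements of $Y_0$ ($X_0$ ordered by $\blacktriangleleft$). Restriction. For consecutive $y,z\in X_0$ (with $y\blacktriangleleft z$), $X(y,z)$ is the globular cardinal with $X(y,z)_k=\{x\in X_{k+1} : y\blacktriangleleft x\blacktriangleleft z\}$ and the source and target maps of $X$ (shifted by one). A morphism $f\colon X\to Y$ restricts to $f(y,z)\colon X(y,z)\to Y(f_0y,f_0z)$. Suspension. For a finite linearly ordered set $A$ write $A\backslash\mathrm{f}$ for $A$ without its first element and $\mathrm{p}x$ for the predecessor of $x\in A\backslash\mathrm{f}$. Given globular cardinals $X(i)$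 for $i\in A\backslash\mathrm{f}$, $\mathrm{su}(X(i),A)$ is the globular set with level $0$ equal to $A$, level $n+1$ equal to $\coprod_i X(i)_n$, source and target on levels $\ge1$ induced by those of the $X(i)$, and source (resp. target) map from level $1$ to level $0$ sending every element of $X(i)_0$ to $\mathrm{p}i$ (resp. $i$). Given an injective order-preserving $f\colon A\to B$ whose image is an interval, and morphisms $f(i)\colon X(i)\to Y(f i)$, $\mathrm{su}(f(i),f)$ is $f$ on level $0$ and $\coprod f(i)_n$ on level $n+1$. Enriched graphs. For a category $\mathcal{V}$, a $\mathcal{V}$-graph $\mathcal{G}$ is a set $\mathrm{Ob}\,\mathcal{G}$ with an object $\mathcal{G}(x,y)$ of $\mathcal{V}$ for all $x,y\in\mathrm{Ob}\,\mathcal{G}$; a morphism $f\colon\mathcal{G}\to\mathcal{H}$ is a map $f\colon\mathrm{Ob}\,\mathcal{G}\to\mathrm{Ob}\,\mathcal{H}$ with morphisms $f(x,y)\colon\mathcal{G}(x,y)\to\mathcal{H}(fx,fy)$ of $\mathcal{V}$. $\mathrm{Graph}_0$ is the category of graphs enriched in the one-object (terminal) category $\{\emptyset\}$, and $\mathrm{Graph}_{n+1}=\mathrm{Graph}_n\text{-Gph}$; $\mathrm{Graph}_{\mathbb{N}}$ is the colimit of the inclusions $\mathrm{Graph}_0\to\mathrm{Graph}_1\to\cdots$ (where $\emptyset$ is identified with the empty graph). Ordinal graphs. If $\mathcal{V}$ has initial object $0$ and $\mathcal{U}\subseteq\mathrm{Ob}\,\mathcal{V}$ contains $0$, a $\mathcal{U}$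 ordinal $\mathcal{V}$-graph is a $\mathcal{V}$-graph $\mathcal{G}$ together with a finite linear order on $\mathrm{Ob}\,\mathcal{G}$, with all $\mathcal{G}(x,y)\in\mathcal{U}$, and with $\mathcal{G}(x,y)\ne0$ if and only if $y$ is the successor of $x$; morphisms are morphisms of $\mathcal{V}$-graphs. $\mathrm{OGraph}_0$ is the category of $\{\emptyset\}$ ordinal $\{\emptyset\}$-graphs, $\mathrm{OGraph}_{n+1}$ is the category of $\mathrm{Ob}(\mathrm{OGraph}_n)$ ordinal $\mathrm{Graph}_n$-graphs, and $\mathrm{OGraph}$ is the colimit of the inclusions $\mathrm{OGraph}_0\to\mathrm{OGraph}_1\to\cdots$. The empty graph has dimension $-1$; objects of $\mathrm{OGraph}_n$ have dimension $n$. (Object maps of morphisms of ordinal graphs are automatically injective and order-preserving with image an interval.) The functors, defined by induction on dimension. $\Gamma$ sends the empty globular cardinal to the empty ordinal graph; otherwise $\Gamma X=\mathcal{G}$ with $\mathrm{Ob}\,\mathcal{G}=X_0$, $\mathcal{G}(\mathrm{p}x,x)=\Gamma(X(\mathrm{p}x,x))$ for $x\in X_0\backslash\mathrm{f}$, and all other edge-objects empty. A morphism $f$ with nonempty domain goes to the morphism with object map $f_0$ and edge components $\Gamma(f(\mathrm{p}x,x))$; if the domain is empty it goes to the unique morphism. $\Gamma'$ sends the empty ordinal graph to the empty globular cardinal; otherwise $\Gamma'\mathcal{G}=\mathrm{su}(\Gamma'\mathcal{G}(\mathrm{p}x,x),\mathrm{Ob}\,\mathcal{G})$, and $\Gamma'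 g=\mathrm{su}(\Gamma' g(\mathrm{p}x,x),g)$ on morphisms (the unique morphism if the domain is empty). *)

theory Defs
  imports Main "HOL-Library.FuncSet"
begin

section \<open>Categories\<close>

text \<open>
  Hom-sets are indexed by domain and codomain, so a morphism need not determine them; this is why
  composition \<open>Comp C X Y Z g f\<close> (of \<open>f : X \<rightarrow> Y\<close> with \<open>g : Y \<rightarrow> Z\<close>) and the action of a functor on
  morphisms take the objects as arguments.
\<close>

record ('o, 'm) category =
  Obj :: "'o set"
  Hom :: "'o \<Rightarrow> 'o \<Rightarrow> 'm set"
  Id :: "'o \<Rightarrow> 'm"
  Comp :: "'o \<Rightarrow> 'o \<Rightarrow> 'o \<Rightarrow> 'm \<Rightarrow> 'm \<Rightarrow> 'm"

definition is_category :: "('o, 'm) category \<Rightarrow> bool" where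
  "is_category C \<longleftrightarrow>
     (\<forall>X\<in>Obj C. Id C X \<in> Hom C X X) \<and>
     (\<forall>X\<in>Obj C. \<forall>Y\<in>Obj C. \<forall>Z\<in>Obj C. \<forall>f\<in>Hom C X Y. \<forall>g\<in>Hom C Y Z.
        Comp C X Y Z g f \<in> Hom C X Z) \<and>
     (\<forall>X\<in>Obj C. \<forall>Y\<in>Obj C. \<forall>f\<in>Hom C X Y.
        Comp C X X Y f (Id C X) = f \<and> Comp C X Y Y (Id C Y) f = f) \<and>
     (\<forall>W\<in>Obj C. \<forall>X\<in>Obj C. \<forall>Y\<in>Obj C. \<forall>Z\<in>Obj C.
        \<forall>f\<in>Hom C W X. \<forall>g\<in>Hom C X Y. \<forall>h\<in>Hom C Y Z.
          Comp C W X Z (Comp C X Y Z h g) f = Comp C W Y Z h (Comp C W X Y g f))"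

definition is_iso :: "('o, 'm) category \<Rightarrow> 'o \<Rightarrow> 'o \<Rightarrow> 'm \<Rightarrow> bool" where
  "is_iso C X Y f \<longleftrightarrow>
     f \<in> Hom C X Y \<and>
     (\<exists>g\<in>Hom C Y X. Comp C X Y X g f = Id C X \<and> Comp C Y X Y f g = Id C Y)"

record ('o, 'm, 'p, 'n) fnctr =
  on_obj :: "'o \<Rightarrow> 'p"
  on_mor :: "'o \<Rightarrow> 'o \<Rightarrow> 'm \<Rightarrow> 'n"

definition is_functor ::
  "('o, 'm) category \<Rightarrow> ('p, 'n) category \<Rightarrow> ('o, 'm, 'p, 'n) fnctr \<Rightarrow> bool" where
  "is_functor C D F \<longleftrightarrow>
     is_category C \<and> is_category D \<and>
     (\<forall>X\<in>Obj C. on_obj F X \<in> Obj D) \<and>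
     (\<forall>X\<in>Obj C. \<forall>Y\<in>Obj C. \<forall>f\<in>Hom C X Y.
        on_mor F X Y f \<in> Hom D (on_obj F X) (on_obj F Y)) \<and>
     (\<forall>X\<in>Obj C. on_mor F X X (Id C X) = Id D (on_obj F X)) \<and>
     (\<forall>X\<in>Obj C. \<forall>Y\<in>Obj C. \<forall>Z\<in>Obj C. \<forall>f\<in>Hom C X Y. \<forall>g\<in>Hom C Y Z.
        on_mor F X Z (Comp C X Y Z g f) =
          Comp D (on_obj F X) (on_obj F Y) (on_obj F Z) (on_mor F Y Z g) (on_mor F X Y f))"

definition id_functor :: "('o, 'm, 'o, 'm) fnctr" where
  "id_functor = \<lparr>on_obj = (\<lambda>X. X), on_mor = (\<lambda>X Y f. f)\<rparr>"

definition comp_functor ::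
  "('p, 'n, 'q, 'k) fnctr \<Rightarrow> ('o, 'm, 'p, 'n) fnctr \<Rightarrow> ('o, 'm, 'q, 'k) fnctr" where
  "comp_functor G F =
     \<lparr>on_obj = (\<lambda>X. on_obj G (on_obj F X)),
      on_mor = (\<lambda>X Y f. on_mor G (on_obj F X) (on_obj F Y) (on_mor F X Y f))\<rparr>"

definition is_natural_iso ::
  "('o, 'm) category \<Rightarrow> ('p, 'n) category \<Rightarrow> ('o, 'm, 'p, 'n) fnctr \<Rightarrow> ('o, 'm, 'p, 'n) fnctr \<Rightarrow>
   ('o \<Rightarrow> 'n) \<Rightarrow> bool" where
  "is_natural_iso C D F G \<alpha> \<longleftrightarrow>
     (\<forall>X\<in>Obj C. is_iso D (on_obj F X) (on_obj G X) (\<alpha> X)) \<and>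
     (\<forall>X\<in>Obj C. \<forall>Y\<in>Obj C. \<forall>f\<in>Hom C X Y.
        Comp D (on_obj F X) (on_obj F Y) (on_obj G Y) (\<alpha> Y) (on_mor F X Y f) =
        Comp D (on_obj F X) (on_obj G X) (on_obj G Y) (on_mor G X Y f) (\<alpha> X))"

definition is_equivalence_with_inverse ::
  "('o, 'm) category \<Rightarrow> ('p, 'n) category \<Rightarrow> ('o, 'm, 'p, 'n) fnctr \<Rightarrow> ('p, 'n, 'o, 'm) fnctr \<Rightarrow>
   bool" where
  "is_equivalence_with_inverse C D F G \<longleftrightarrow>
     is_functor C D F \<and> is_functor D C G \<and>
     (\<exists>\<eta>. is_natural_iso C C id_functor (comp_functor G F) \<eta>) \<and>
     (\<exists>\<epsilon>. is_natural_iso D D (comp_functor F G) id_functor \<epsilon>)"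

text \<open>
  The colimit of a sequence of full inclusions \<open>C 0 \<rightarrow> C 1 \<rightarrow> \<dots>\<close> that are identities on objects and
  morphisms: the union of the categories. Any index \<open>n\<close> containing the objects concerned gives the
  same hom-sets, identities and composites.
\<close>

definition union_category :: "(nat \<Rightarrow> ('o, 'm) category) \<Rightarrow> ('o, 'm) category" where
  "union_category C =
     \<lparr>Obj = (\<Union>n. Obj (C n)),
      Hom = (\<lambda>X Y. {f. \<exists>n. X \<in> Obj (C n) \<and> Y \<in> Obj (C n) \<and> f \<in> Hom (C n) X Y}),
      Id = (\<lambda>X. Id (C (LEAST n. X \<in> Obj (C n))) X),
      Comp = (\<lambda>X Y Z. Comp (C (LEAST n. X \<in> Obj (C n) \<and> Y \<in> Obj (C n) \<and> Z \<in> Obj (C n))) X Y Z)\<rparr>"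


section \<open>Finite linear orders\<close>

definition is_succ :: "'a rel \<Rightarrow> 'a \<Rightarrow> 'a \<Rightarrow> bool" where
  "is_succ r x y \<longleftrightarrow> (x, y) \<in> r \<and> x \<noteq> y \<and> (\<forall>z. (x, z) \<in> r \<and> (z, y) \<in> r \<longrightarrow> z = x \<or> z = y)"

definition pre :: "'a rel \<Rightarrow> 'a \<Rightarrow> 'a" where
  "pre r y = (THE x. is_succ r x y)"

definition non_first :: "'a set \<Rightarrow> 'a rel \<Rightarrow> 'a set" where
  "non_first A r = {x \<in> A. \<not> (\<forall>a\<in>A. (x, a) \<in> r)}"


section \<open>Globular cardinals\<close>

text \<open>
  All sets are subsets of a single type \<open>'u\<close>. The levels of a globular set may overlap as subsets of \<open>'u\<close>;
  the set of all its elements is the disjoint union \<open>vertices\<close>. Functions are extensional, so that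
  equality of objects and morphisms is the intended one.
\<close>

record 'u gset =
  lev :: "nat \<Rightarrow> 'u set"
  src :: "nat \<Rightarrow> 'u \<Rightarrow> 'u"
  tgt :: "nat \<Rightarrow> 'u \<Rightarrow> 'u"

type_synonym 'u gset_mor = "nat \<Rightarrow> 'u \<Rightarrow> 'u"

definition is_globular_set :: "'u gset \<Rightarrow> bool" where
  "is_globular_set X \<longleftrightarrow>
     (\<forall>n. src X n \<in> lev X (Suc n) \<rightarrow>\<^sub>E lev X n) \<and>
     (\<forall>n. tgt X n \<in> lev X (Suc n) \<rightarrow>\<^sub>E lev X n) \<and>
     (\<forall>n. \<forall>x\<in>lev X (Suc (Suc n)).
        src X n (src X (Suc n) x) = src X n (tgt X (Suc n) x) \<and>
        tgt X n (src X (Suc n) x) = tgt X n (tgt X (Suc n) x))"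

definition GlobSet :: "('u gset, 'u gset_mor) category" where
  "GlobSet =
     \<lparr>Obj = {X. is_globular_set X},
      Hom = (\<lambda>X Y. {f. (\<forall>n. f n \<in> lev X n \<rightarrow>\<^sub>E lev Y n) \<and>
                       (\<forall>n. \<forall>x\<in>lev X (Suc n).
                          f n (src X n x) = src Y n (f (Suc n) x) \<and>
                          f n (tgt X n x) = tgt Y n (f (Suc n) x))}),
      Id = (\<lambda>X n. \<lambda>x\<in>lev X n. x),
      Comp = (\<lambda>X Y Z g f n. \<lambda>x\<in>lev X n. g n (f n x))\<rparr>"

definition vertices :: "'u gset \<Rightarrow> (nat \<times> 'u) set" where
  "vertices X = (SIGMA n:UNIV. lev X n)"

definition prec :: "'u gset \<Rightarrow> (nat \<times> 'u) rel" where
  "prec X = {((n, src X n y), (Suc n, y)) | n y. y \<in> lev X (Suc n)} \<union>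
            {((Suc n, x), (n, tgt X n x)) | n x. x \<in> lev X (Suc n)}"

definition tri :: "'u gset \<Rightarrow> (nat \<times> 'u) rel" where
  "tri X = (prec X)\<^sup>* \<inter> vertices X \<times> vertices X"

definition is_globular_cardinal :: "'u gset \<Rightarrow> bool" where
  "is_globular_cardinal X \<longleftrightarrow>
     is_globular_set X \<and> finite (vertices X) \<and> linear_order_on (vertices X) (tri X)"

definition GlobCard :: "('u gset, 'u gset_mor) category" where
  "GlobCard = GlobSet\<lparr>Obj := {X. is_globular_cardinal X}\<rparr>"

definition order0 :: "'u gset \<Rightarrow> 'u rel" where
  "order0 X = {(x, y). x \<in> lev X 0 \<and> y \<in> lev X 0 \<and> ((0, x), (0, y)) \<in> tri X}"

definition empty_gset :: "'u gset" where
  "empty_gset = \<lparr>lev = (\<lambda>n. {}), src = (\<lambda>n x. undefined), tgt = (\<lambda>n x. undefined)\<rparr>"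

definition empty_gset_mor :: "'u gset_mor" where
  "empty_gset_mor = (\<lambda>n x. undefined)"


subsection \<open>Restriction\<close>

definition restr_lev :: "'u gset \<Rightarrow> 'u \<Rightarrow> 'u \<Rightarrow> nat \<Rightarrow> 'u set" where
  "restr_lev X y z k =
     {x \<in> lev X (Suc k). ((0, y), (Suc k, x)) \<in> tri X \<and> ((Suc k, x), (0, z)) \<in> tri X}"

definition restr :: "'u gset \<Rightarrow> 'u \<Rightarrow> 'u \<Rightarrow> 'u gset" where
  "restr X y z =
     \<lparr>lev = restr_lev X y z,
      src = (\<lambda>k. restrict (src X (Suc k)) (restr_lev X y z (Suc k))),
      tgt = (\<lambda>k. restrict (tgt X (Suc k)) (restr_lev X y z (Suc k)))\<rparr>"

definition restr_mor :: "'u gset \<Rightarrow> 'u gset_mor \<Rightarrow> 'u \<Rightarrow> 'u \<Rightarrow> 'u gset_mor" where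
  "restr_mor X f y z = (\<lambda>k. restrict (f (Suc k)) (restr_lev X y z k))"


subsection \<open>Suspension\<close>

text \<open>
  The parameter \<open>pair\<close> is an injection that embeds \<open>'u \<times> 'u\<close> in the universe \<open>'u\<close>; it encodes the
  coproduct of the sets \<open>X i\<close>, \<open>i \<in> I\<close>, as \<open>pair ` (SIGMA i:I. X i)\<close>.
\<close>

definition su_lev :: "('u \<times> 'u \<Rightarrow> 'u) \<Rightarrow> ('u \<Rightarrow> 'u gset) \<Rightarrow> 'u set \<Rightarrow> 'u rel \<Rightarrow> nat \<Rightarrow> 'u set" where
  "su_lev pair X A r n =
     (case n of 0 \<Rightarrow> A | Suc m \<Rightarrow> pair ` (SIGMA i:non_first A r. lev (X i) m))"

definition su :: "('u \<times> 'u \<Rightarrow> 'u) \<Rightarrow> ('u \<Rightarrow> 'u gset) \<Rightarrow> 'u set \<Rightarrow> 'u rel \<Rightarrow> 'u gset" where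
  "su pair X A r =
     \<lparr>lev = su_lev pair X A r,
      src = (\<lambda>n. \<lambda>v\<in>su_lev pair X A r (Suc n). let (i, x) = inv pair v in
               (case n of 0 \<Rightarrow> pre r i | Suc m \<Rightarrow> pair (i, src (X i) m x))),
      tgt = (\<lambda>n. \<lambda>v\<in>su_lev pair X A r (Suc n). let (i, x) = inv pair v in
               (case n of 0 \<Rightarrow> i | Suc m \<Rightarrow> pair (i, tgt (X i) m x)))\<rparr>"

text \<open>The morphism \<open>su(F(i), f)\<close> with domain \<open>su(X(i), A)\<close>, where \<open>F i\<close> has domain \<open>X i\<close>.\<close>

definition su_mor ::
  "('u \<times> 'u \<Rightarrow> 'u) \<Rightarrow> ('u \<Rightarrow> 'u gset) \<Rightarrow> 'u set \<Rightarrow> 'u rel \<Rightarrow> ('u \<Rightarrow> 'u gset_mor) \<Rightarrow> ('u \<Rightarrow> 'u) \<Rightarrow>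
   'u gset_mor" where
  "su_mor pair X A r F f =
     (\<lambda>n. \<lambda>v\<in>su_lev pair X A r n.
        (case n of 0 \<Rightarrow> f v | Suc m \<Rightarrow> let (i, x) = inv pair v in pair (f i, F i m x)))"


section \<open>Iterated enriched graphs\<close>

text \<open>
  Graphs of all finite dimensions live in one type, in which the inclusions \<open>Graph\<^sub>n \<rightarrow> Graph\<^sub>n\<^sub>+\<^sub>1\<close> are
  identities. \<open>EmptyGraph\<close> is both the object of \<open>Graph\<^sub>0\<close> and the empty graph, and \<open>EmptyMor\<close> is
  the unique morphism out of it. Therefore \<open>MkGraph\<close> and \<open>MkMor\<close> are only used for a nonempty set
  of objects; \<open>graph_of\<close> and \<open>mor_of\<close> take care of this and of extensionality.
\<close>

datatype 'u graph =
    EmptyGraph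
  | MkGraph (Ob: "'u set") (edge: "'u \<Rightarrow> 'u \<Rightarrow> 'u graph")
  where
    "Ob EmptyGraph = {}"
  | "edge EmptyGraph = (\<lambda>x y. EmptyGraph)"

datatype 'u graph_mor =
    EmptyMor
  | MkMor (ob_map: "'u \<Rightarrow> 'u") (edge_mor: "'u \<Rightarrow> 'u \<Rightarrow> 'u graph_mor")
  where
    "ob_map EmptyMor = (\<lambda>x. undefined)"
  | "edge_mor EmptyMor = (\<lambda>x y. EmptyMor)"

definition graph_of :: "'u set \<Rightarrow> ('u \<Rightarrow> 'u \<Rightarrow> 'u graph) \<Rightarrow> 'u graph" where
  "graph_of A E =
     (if A = {} then EmptyGraph
      else MkGraph A (\<lambda>x y. if x \<in> A \<and> y \<in> A then E x y else EmptyGraph))"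

definition mor_of ::
  "'u set \<Rightarrow> ('u \<Rightarrow> 'u) \<Rightarrow> ('u \<Rightarrow> 'u \<Rightarrow> 'u graph_mor) \<Rightarrow> 'u graph_mor" where
  "mor_of A f F =
     (if A = {} then EmptyMor
      else MkMor (restrict f A) (\<lambda>x y. if x \<in> A \<and> y \<in> A then F x y else EmptyMor))"

definition enriched_graphs ::
  "('u graph, 'u graph_mor) category \<Rightarrow> ('u graph, 'u graph_mor) category" where
  "enriched_graphs V =
     \<lparr>Obj = {graph_of A E | A E. \<forall>x\<in>A. \<forall>y\<in>A. E x y \<in> Obj V},
      Hom = (\<lambda>G H. {mor_of (Ob G) f F | f F.
               (\<forall>x\<in>Ob G. f x \<in> Ob H) \<and>
               (\<forall>x\<in>Ob G. \<forall>y\<in>Ob G. F x y \<in> Hom V (edge G x y) (edge H (f x) (f y)))}),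
      Id = (\<lambda>G. mor_of (Ob G) (\<lambda>x. x) (\<lambda>x y. Id V (edge G x y))),
      Comp = (\<lambda>G H K g f. mor_of (Ob G) (\<lambda>x. ob_map g (ob_map f x))
               (\<lambda>x y. Comp V (edge G x y)
                        (edge H (ob_map f x) (ob_map f y))
                        (edge K (ob_map g (ob_map f x)) (ob_map g (ob_map f y)))
                        (edge_mor g (ob_map f x) (ob_map f y)) (edge_mor f x y)))\<rparr>"

primrec GraphCat :: "nat \<Rightarrow> ('u graph, 'u graph_mor) category" where
  "GraphCat 0 =
     \<lparr>Obj = {EmptyGraph}, Hom = (\<lambda>G H. {EmptyMor}), Id = (\<lambda>G. EmptyMor),
      Comp = (\<lambda>G H K g f. EmptyMor)\<rparr>"
| "GraphCat (Suc n) = enriched_graphs (GraphCat n)"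


section \<open>Ordinal graphs\<close>

text \<open>
  An ordinal graph carries a linear order on its objects, and so do, recursively, its edge-objects.
\<close>

datatype 'u ograph =
    EmptyOGraph
  | MkOGraph (OOb: "'u set") (ord: "'u rel") (oedge: "'u \<Rightarrow> 'u \<Rightarrow> 'u ograph")
  where
    "OOb EmptyOGraph = {}"
  | "ord EmptyOGraph = {}"
  | "oedge EmptyOGraph = (\<lambda>x y. EmptyOGraph)"

definition ograph_of :: "'u set \<Rightarrow> 'u rel \<Rightarrow> ('u \<Rightarrow> 'u \<Rightarrow> 'u ograph) \<Rightarrow> 'u ograph" where
  "ograph_of A r E =
     (if A = {} then EmptyOGraph
      else MkOGraph A r (\<lambda>x y. if x \<in> A \<and> y \<in> A then E x y else EmptyOGraph))"

primrec underlying :: "'u ograph \<Rightarrow> 'u graph" where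
  "underlying EmptyOGraph = EmptyGraph"
| "underlying (MkOGraph A r E) = MkGraph A (\<lambda>x y. underlying (E x y))"

text \<open>
  The category of \<open>\<U>\<close> ordinal \<open>\<V>\<close>-graphs, for \<open>\<V>\<close> some \<open>Graph\<^sub>n\<close> (whose initial object is the empty
  graph) and \<open>\<U>\<close> a set of ordinal graphs with underlying graph in \<open>\<V>\<close>.
\<close>

definition ordinal_graphs ::
  "'u ograph set \<Rightarrow> ('u graph, 'u graph_mor) category \<Rightarrow> ('u ograph, 'u graph_mor) category" where
  "ordinal_graphs U V =
     \<lparr>Obj = {ograph_of A r E | A r E.
               finite A \<and> linear_order_on A r \<and>
               (\<forall>x\<in>A. \<forall>y\<in>A. E x y \<in> U \<and> underlying (E x y) \<in> Obj V) \<and>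
               (\<forall>x\<in>A. \<forall>y\<in>A. E x y \<noteq> EmptyOGraph \<longleftrightarrow> is_succ r x y)},
      Hom = (\<lambda>G H. Hom (enriched_graphs V) (underlying G) (underlying H)),
      Id = (\<lambda>G. Id (enriched_graphs V) (underlying G)),
      Comp = (\<lambda>G H K. Comp (enriched_graphs V) (underlying G) (underlying H) (underlying K))\<rparr>"

text \<open>
  \<open>OGraph\<^sub>0\<close> consists of \<open>\<emptyset>\<close> and the one-point graphs, which are objects of \<open>Graph\<^sub>1\<close>. In general the
  objects of \<open>OGraph\<^sub>n\<close> have their underlying graph in \<open>Graph\<^sub>n\<^sub>+\<^sub>1\<close>, which is thus the enriching
  category in the recursion step.
\<close>

primrec OGraphCat :: "nat \<Rightarrow> ('u ograph, 'u graph_mor) category" where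
  "OGraphCat 0 = ordinal_graphs {EmptyOGraph} (GraphCat 0)"
| "OGraphCat (Suc n) = ordinal_graphs (Obj (OGraphCat n)) (GraphCat (Suc n))"

definition OGraph :: "('u ograph, 'u graph_mor) category" where
  "OGraph = union_category OGraphCat"


section \<open>The functors\<close>

lemma globular_cardinal_bound:
  assumes "is_globular_cardinal X"
  shows "\<exists>n. \<forall>m\<ge>n. lev X m = {}"
proof -
  have "finite (fst ` vertices X)"
    using assms by (simp add: is_globular_cardinal_def)
  then obtain n where n: "\<forall>k\<in>fst ` vertices X. k < n"
    using finite_nat_set_iff_bounded by auto
  have "lev X m = {}" if "m \<ge> n" for m
  proof (rule ccontr)
    assume "lev X m \<noteq> {}"
    then have "m \<in> fst ` vertices X"
      by (force simp: vertices_def)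
    with n that show False by auto
  qed
  then show ?thesis by blast
qed

text \<open>The dimension plus one.\<close>

definition height :: "'u gset \<Rightarrow> nat" where
  "height X = (LEAST n. \<forall>m\<ge>n. lev X m = {})"

lemma height_restr:
  assumes "is_globular_cardinal X" and "lev X 0 \<noteq> {}"
  shows "height (restr X y z) < height X"
proof -
  have h: "\<forall>m\<ge>height X. lev X m = {}"
    unfolding height_def by (rule LeastI_ex[OF globular_cardinal_bound[OF assms(1)]])
  with assms(2) obtain k where k: "height X = Suc k"
    by (cases "height X") auto
  have "\<forall>m\<ge>k. lev (restr X y z) m = {}"
    using h k by (auto simp: restr_def restr_lev_def)
  then have "height (restr X y z) \<le> k"
    unfolding height_def by (rule Least_le)
  with k show ?thesis by simp
qed

function Gamma_obj :: "'u gset \<Rightarrow> 'u ograph" where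
  "Gamma_obj X =
     (if is_globular_cardinal X \<and> lev X 0 \<noteq> {} then
        MkOGraph (lev X 0) (order0 X)
          (\<lambda>x y. if y \<in> non_first (lev X 0) (order0 X) \<and> x = pre (order0 X) y
                  then Gamma_obj (restr X x y) else EmptyOGraph)
      else EmptyOGraph)"
  by auto
termination
  by (relation "measure height") (auto simp: height_restr)

function Gamma_mor :: "'u gset \<Rightarrow> 'u gset_mor \<Rightarrow> 'u graph_mor" where
  "Gamma_mor X f =
     (if is_globular_cardinal X \<and> lev X 0 \<noteq> {} then
        MkMor (f 0)
          (\<lambda>x y. if y \<in> non_first (lev X 0) (order0 X) \<and> x = pre (order0 X) y
                  then Gamma_mor (restr X x y) (restr_mor X f x y) else EmptyMor)
      else EmptyMor)"
  by auto
termination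
  by (relation "measure (\<lambda>(X, f). height X)") (auto simp: height_restr)

declare Gamma_obj.simps [simp del] Gamma_mor.simps [simp del]

definition Gamma :: "('u gset, 'u gset_mor, 'u ograph, 'u graph_mor) fnctr" where
  "Gamma = \<lparr>on_obj = Gamma_obj, on_mor = (\<lambda>X Y f. Gamma_mor X f)\<rparr>"

primrec Gamma'_obj :: "('u \<times> 'u \<Rightarrow> 'u) \<Rightarrow> 'u ograph \<Rightarrow> 'u gset" where
  "Gamma'_obj pair EmptyOGraph = empty_gset"
| "Gamma'_obj pair (MkOGraph A r E) =
     su pair (\<lambda>x. Gamma'_obj pair (E (pre r x) x)) A r"

primrec Gamma'_mor :: "('u \<times> 'u \<Rightarrow> 'u) \<Rightarrow> 'u ograph \<Rightarrow> 'u graph_mor \<Rightarrow> 'u gset_mor" where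
  "Gamma'_mor pair EmptyOGraph g = empty_gset_mor"
| "Gamma'_mor pair (MkOGraph A r E) g =
     su_mor pair (\<lambda>x. Gamma'_obj pair (E (pre r x) x)) A r
       (\<lambda>x. Gamma'_mor pair (E (pre r x) x) (edge_mor g (pre r x) x)) (ob_map g)"

definition Gamma' ::
  "('u \<times> 'u \<Rightarrow> 'u) \<Rightarrow> ('u ograph, 'u graph_mor, 'u gset, 'u gset_mor) fnctr" where
  "Gamma' pair = \<lparr>on_obj = Gamma'_obj pair, on_mor = (\<lambda>G H g. Gamma'_mor pair G g)\<rparr>"

end

theory Submission imports Defs begin

text \<open>
  The idea is that a nonempty globular cardinal \<open>X\<close> is the suspension of its restrictions to
  consecutive vertices of level \<open>0\<close>. Linearity forces each such vertex to lie weakly before the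
  iterated source or weakly after the iterated target of a given cell, because a path between the
  vertex and the cell has to pass through that end (\<open>prec_path_cases\<close>). Hence the ends of a cell are
  consecutive, and consecutive vertices are the ends of some \<open>1\<close>-cell (\<open>is_succ_order0_iff\<close>). A cell of
  positive dimension is therefore given by its iterated target \<open>i\<close> together with itself as a cell of
  the restriction between the predecessor of \<open>i\<close> and \<open>i\<close>. Replacing the cell by this pair, and the
  second component recursively in the same way, is a map \<open>eta\<close> from \<open>X\<close> to \<open>\<Gamma>' (\<Gamma> X)\<close>, which is
  bijective on each level and natural (\<open>eta_bij_and_commutes\<close>, \<open>eta_natural\<close>).

  In the other direction, \<open>\<Gamma>'\<close> is fully faithful. A morphism between suspensions preserves iterated
  targets, so it maps summands to summands and splits into components, to which the induction
  hypothesis applies (\<open>Gamma'_full\<close>). The remaining edge-objects of an ordinal graph are empty, and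
  there is only one morphism out of them, so nothing is lost (\<open>Gamma'_faithful\<close>). A fully faithful
  functor together with a natural isomorphism \<open>X \<cong> \<Gamma>' (\<Gamma> X)\<close> is an equivalence with inverse \<open>\<Gamma>\<close> for
  formal reasons (\<open>equivalence_if_inverse_fully_faithful\<close>).

  The values of the two functors lie in the right categories because restrictions and suspensions
  of globular cardinals are globular cardinals (\<open>is_globular_cardinal_restr\<close>,
  \<open>is_globular_cardinal_su\<close>). The colimit that defines \<open>OGraph\<close> is made manageable by describing
  ordinal graphs of all dimensions, and their morphisms, by structural recursion (\<open>OGraph_Obj\<close>,
  \<open>OGraph_Hom\<close>).
\<close>

section \<open>A criterion for an equivalence of categories\<close>

lemma is_categoryD:
  assumes "is_category C"
  shows Id_in_Hom: "X \<in> Obj C \<Longrightarrow> Id C X \<in> Hom C X X"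
    and Comp_in_Hom: "\<lbrakk>X \<in> Obj C; Y \<in> Obj C; Z \<in> Obj C; f \<in> Hom C X Y; g \<in> Hom C Y Z\<rbrakk> \<Longrightarrow>
      Comp C X Y Z g f \<in> Hom C X Z"
    and Comp_Id_right: "\<lbrakk>X \<in> Obj C; Y \<in> Obj C; f \<in> Hom C X Y\<rbrakk> \<Longrightarrow> Comp C X X Y f (Id C X) = f"
    and Comp_Id_left: "\<lbrakk>X \<in> Obj C; Y \<in> Obj C; f \<in> Hom C X Y\<rbrakk> \<Longrightarrow> Comp C X Y Y (Id C Y) f = f"
    and Comp_assoc: "\<lbrakk>W \<in> Obj C; X \<in> Obj C; Y \<in> Obj C; Z \<in> Obj C; f \<in> Hom C W X; g \<in> Hom C X Y;
      h \<in> Hom C Y Z\<rbrakk> \<Longrightarrow> Comp C W X Z (Comp C X Y Z h g) f = Comp C W Y Z h (Comp C W X Y g f)"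
  using assms unfolding is_category_def by simp_all

lemma iso_right_cancel:
  assumes C: "is_category C" and obj: "X \<in> Obj C" "Y \<in> Obj C" "Z \<in> Obj C"
    and e: "is_iso C X Y e" and f: "f \<in> Hom C Y Z" and g: "g \<in> Hom C Y Z"
    and eq: "Comp C X Y Z f e = Comp C X Y Z g e"
  shows "f = g"
proof -
  obtain e' where e': "e' \<in> Hom C Y X" "Comp C Y X Y e e' = Id C Y"
    using e by (auto simp: is_iso_def)
  have eH: "e \<in> Hom C X Y" using e by (simp add: is_iso_def)
  have "k = Comp C Y X Z (Comp C X Y Z k e) e'" if "k \<in> Hom C Y Z" for k
    using Comp_assoc[OF C obj(2,1,2,3) e'(1) eH that] e'(2) Comp_Id_right[OF C obj(2,3) that] by simp
  from this[OF f] this[OF g] eq show ?thesis by simp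
qed

text \<open>
  Functoriality of \<open>F\<close> is a family of equations in \<open>D\<close>, which the faithful functor \<open>G\<close> reflects from
  \<open>C\<close>. There they hold since, by naturality of \<open>\<eta>\<close>, the composite \<open>G F\<close> is conjugation by \<open>\<eta>\<close>. Likewise
  the inverse of \<open>\<eta> (G X)\<close> goes from \<open>G (F (G X))\<close> to \<open>G X\<close>, and fullness lifts it to the isomorphism
  from \<open>F (G X)\<close> to \<open>X\<close> that the equivalence requires.
\<close>

lemma equivalence_if_inverse_fully_faithful:
  assumes G: "is_functor D C G"
    and F_obj: "\<And>X. X \<in> Obj C \<Longrightarrow> on_obj F X \<in> Obj D"
    and F_mor: "\<And>X Y f. \<lbrakk>X \<in> Obj C; Y \<in> Obj C; f \<in> Hom C X Y\<rbrakk> \<Longrightarrow>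
      on_mor F X Y f \<in> Hom D (on_obj F X) (on_obj F Y)"
    and eta: "is_natural_iso C C id_functor (comp_functor G F) \<eta>"
    and faithful: "\<And>X Y f g. \<lbrakk>X \<in> Obj D; Y \<in> Obj D; f \<in> Hom D X Y; g \<in> Hom D X Y;
      on_mor G X Y f = on_mor G X Y g\<rbrakk> \<Longrightarrow> f = g"
    and full: "\<And>X Y h. \<lbrakk>X \<in> Obj D; Y \<in> Obj D; h \<in> Hom C (on_obj G X) (on_obj G Y)\<rbrakk> \<Longrightarrow>
      \<exists>f\<in>Hom D X Y. on_mor G X Y f = h"
  shows "is_equivalence_with_inverse C D F G"
proof -
  have C: "is_category C" and D: "is_category D"
    using G by (auto simp: is_functor_def)
  have G_obj: "on_obj G X \<in> Obj C" if "X \<in> Obj D" for X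
    using G that by (auto simp: is_functor_def)
  have G_mor: "on_mor G X Y f \<in> Hom C (on_obj G X) (on_obj G Y)"
    if "X \<in> Obj D" "Y \<in> Obj D" "f \<in> Hom D X Y" for X Y f
    using G that by (auto simp: is_functor_def)
  have G_Id: "on_mor G X X (Id D X) = Id C (on_obj G X)" if "X \<in> Obj D" for X
    using G that by (auto simp: is_functor_def)
  have G_Comp: "on_mor G X Z (Comp D X Y Z g f) =
      Comp C (on_obj G X) (on_obj G Y) (on_obj G Z) (on_mor G Y Z g) (on_mor G X Y f)"
    if "X \<in> Obj D" "Y \<in> Obj D" "Z \<in> Obj D" "f \<in> Hom D X Y" "g \<in> Hom D Y Z" for X Y Z f g
    using G that by (auto simp: is_functor_def)
  let ?GF = "\<lambda>X. on_obj G (on_obj F X)"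
  let ?GFm = "\<lambda>X Y f. on_mor G (on_obj F X) (on_obj F Y) (on_mor F X Y f)"
  have iso: "is_iso C X (?GF X) (\<eta> X)" if "X \<in> Obj C" for X
    using eta that by (simp add: is_natural_iso_def id_functor_def comp_functor_def)
  then have eta_Hom: "\<eta> X \<in> Hom C X (?GF X)" if "X \<in> Obj C" for X
    using that by (simp add: is_iso_def)
  have nat: "Comp C X Y (?GF Y) (\<eta> Y) f = Comp C X (?GF X) (?GF Y) (?GFm X Y f) (\<eta> X)"
    if "X \<in> Obj C" "Y \<in> Obj C" "f \<in> Hom C X Y" for X Y f
    using eta that by (simp add: is_natural_iso_def id_functor_def comp_functor_def)
  have GF_mor: "?GFm X Y f \<in> Hom C (?GF X) (?GF Y)" if "X \<in> Obj C" "Y \<in> Obj C" "f \<in> Hom C X Y" for X Y f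
    using that by (intro G_mor F_obj F_mor)

  have F_Id: "on_mor F X X (Id C X) = Id D (on_obj F X)" if X: "X \<in> Obj C" for X
  proof (rule faithful)
    have GX: "?GF X \<in> Obj C" by (intro G_obj F_obj X)
    have IdX: "Id C X \<in> Hom C X X" by (rule Id_in_Hom[OF C X])
    have "Comp C X (?GF X) (?GF X) (?GFm X X (Id C X)) (\<eta> X) =
        Comp C X (?GF X) (?GF X) (Id C (?GF X)) (\<eta> X)"
      by (simp only: nat[OF X X IdX, symmetric] Comp_Id_right[OF C X GX eta_Hom[OF X]]
          Comp_Id_left[OF C X GX eta_Hom[OF X]])
    then have "?GFm X X (Id C X) = Id C (?GF X)"
      by (rule iso_right_cancel[OF C X GX GX iso[OF X] GF_mor[OF X X IdX] Id_in_Hom[OF C GX]])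
    then show "?GFm X X (Id C X) = on_mor G (on_obj F X) (on_obj F X) (Id D (on_obj F X))"
      by (simp only: G_Id[OF F_obj[OF X]])
  qed (intro X F_obj F_mor Id_in_Hom[OF C] Id_in_Hom[OF D])+

  have F_Comp: "on_mor F X Z (Comp C X Y Z g f) =
      Comp D (on_obj F X) (on_obj F Y) (on_obj F Z) (on_mor F Y Z g) (on_mor F X Y f)"
    if X: "X \<in> Obj C" and Y: "Y \<in> Obj C" and Z: "Z \<in> Obj C"
      and f: "f \<in> Hom C X Y" and g: "g \<in> Hom C Y Z" for X Y Z f g
  proof (rule faithful)
    have gf: "Comp C X Y Z g f \<in> Hom C X Z" by (rule Comp_in_Hom[OF C X Y Z f g])
    have GX: "?GF X \<in> Obj C" "?GF Y \<in> Obj C" "?GF Z \<in> Obj C"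
      by (auto intro!: G_obj F_obj X Y Z)
    note FX = F_obj[OF X] F_obj[OF Y] F_obj[OF Z]
    note Ff = F_mor[OF X Y f] and Fg = F_mor[OF Y Z g]
    note Gf = GF_mor[OF X Y f] and Gg = GF_mor[OF Y Z g]
    have "Comp C X (?GF X) (?GF Z) (?GFm X Z (Comp C X Y Z g f)) (\<eta> X)
        = Comp C X Z (?GF Z) (\<eta> Z) (Comp C X Y Z g f)"
      by (rule nat[OF X Z gf, symmetric])
    also have "\<dots> = Comp C X Y (?GF Z) (Comp C Y Z (?GF Z) (\<eta> Z) g) f"
      by (rule Comp_assoc[OF C X Y Z GX(3) f g eta_Hom[OF Z], symmetric])
    also have "\<dots> = Comp C X Y (?GF Z) (Comp C Y (?GF Y) (?GF Z) (?GFm Y Z g) (\<eta> Y)) f"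
      by (simp only: nat[OF Y Z g])
    also have "\<dots> = Comp C X (?GF Y) (?GF Z) (?GFm Y Z g) (Comp C X Y (?GF Y) (\<eta> Y) f)"
      by (rule Comp_assoc[OF C X Y GX(2,3) f eta_Hom[OF Y] Gg])
    also have "\<dots> = Comp C X (?GF Y) (?GF Z) (?GFm Y Z g) (Comp C X (?GF X) (?GF Y) (?GFm X Y f) (\<eta> X))"
      by (simp only: nat[OF X Y f])
    also have "\<dots> = Comp C X (?GF X) (?GF Z) (Comp C (?GF X) (?GF Y) (?GF Z) (?GFm Y Z g) (?GFm X Y f)) (\<eta> X)"
      by (rule Comp_assoc[OF C X GX eta_Hom[OF X] Gf Gg, symmetric])
    finally have "?GFm X Z (Comp C X Y Z g f) = Comp C (?GF X) (?GF Y) (?GF Z) (?GFm Y Z g) (?GFm X Y f)"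
      by (rule iso_right_cancel[OF C X GX(1,3) iso[OF X] GF_mor[OF X Z gf] Comp_in_Hom[OF C GX Gf Gg]])
    then show "?GFm X Z (Comp C X Y Z g f) = on_mor G (on_obj F X) (on_obj F Z)
        (Comp D (on_obj F X) (on_obj F Y) (on_obj F Z) (on_mor F Y Z g) (on_mor F X Y f))"
      by (simp only: G_Comp[OF FX Ff Fg])
    show "Comp D (on_obj F X) (on_obj F Y) (on_obj F Z) (on_mor F Y Z g) (on_mor F X Y f)
        \<in> Hom D (on_obj F X) (on_obj F Z)"
      by (rule Comp_in_Hom[OF D FX Ff Fg])
    show "on_mor F X Z (Comp C X Y Z g f) \<in> Hom D (on_obj F X) (on_obj F Z)"
      by (rule F_mor[OF X Z gf])
  qed (intro F_obj X Z)+

  have F: "is_functor C D F"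
    by (simp add: is_functor_def C D F_obj F_mor F_Id F_Comp)

  have "\<exists>e. e \<in> Hom D (on_obj F (on_obj G X)) X \<and> is_iso D (on_obj F (on_obj G X)) X e \<and>
      Comp C (on_obj G X) (?GF (on_obj G X)) (on_obj G X)
        (on_mor G (on_obj F (on_obj G X)) X e) (\<eta> (on_obj G X)) = Id C (on_obj G X)"
    if X: "X \<in> Obj D" for X
  proof -
    let ?A = "on_obj G X"
    let ?B = "on_obj F ?A"
    have A: "?A \<in> Obj C" and B: "?B \<in> Obj D" using X by (auto intro: G_obj F_obj)
    obtain e' where e': "e' \<in> Hom C (on_obj G ?B) ?A"
      "Comp C ?A (on_obj G ?B) ?A e' (\<eta> ?A) = Id C ?A"
      "Comp C (on_obj G ?B) ?A (on_obj G ?B) (\<eta> ?A) e' = Id C (on_obj G ?B)"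
      using iso[OF A] by (auto simp: is_iso_def)
    \<comment> \<open>The lifts of \<open>\<eta> (G X)\<close> and its inverse are inverse to each other because \<open>G\<close> is faithful.\<close>
    obtain e where e: "e \<in> Hom D ?B X" "on_mor G ?B X e = e'" using full[OF B X e'(1)] by blast
    obtain d where d: "d \<in> Hom D X ?B" "on_mor G X ?B d = \<eta> ?A" using full[OF X B eta_Hom[OF A]] by blast
    have "Comp D ?B X ?B d e = Id D ?B"
      by (rule faithful[OF B B]) (auto simp: Comp_in_Hom[OF D B X B e(1) d(1)] Id_in_Hom[OF D B]
        G_Comp[OF B X B e(1) d(1)] G_Id[OF B] e(2) d(2) e'(3))
    moreover have "Comp D X ?B X e d = Id D X"
      by (rule faithful[OF X X]) (auto simp: Comp_in_Hom[OF D X B X d(1) e(1)] Id_in_Hom[OF D X]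
        G_Comp[OF X B X d(1) e(1)] G_Id[OF X] e(2) d(2) e'(2))
    ultimately have "is_iso D ?B X e" using e(1) d(1) by (auto simp: is_iso_def)
    with e e' show ?thesis by auto
  qed
  then obtain \<epsilon> where eps_iso: "\<And>X. X \<in> Obj D \<Longrightarrow> is_iso D (on_obj F (on_obj G X)) X (\<epsilon> X)"
    and eps_Hom: "\<And>X. X \<in> Obj D \<Longrightarrow> \<epsilon> X \<in> Hom D (on_obj F (on_obj G X)) X"
    and eps_left: "\<And>X. X \<in> Obj D \<Longrightarrow> Comp C (on_obj G X) (?GF (on_obj G X)) (on_obj G X)
        (on_mor G (on_obj F (on_obj G X)) X (\<epsilon> X)) (\<eta> (on_obj G X)) = Id C (on_obj G X)"
    by metis

  have "Comp D (on_obj F (on_obj G X)) (on_obj F (on_obj G Y)) Y (\<epsilon> Y)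
      (on_mor F (on_obj G X) (on_obj G Y) (on_mor G X Y g)) =
    Comp D (on_obj F (on_obj G X)) X Y g (\<epsilon> X)"
    if X: "X \<in> Obj D" and Y: "Y \<in> Obj D" and g: "g \<in> Hom D X Y" for X Y g
  proof (rule faithful)
    let ?X = "on_obj G X" and ?Y = "on_obj G Y"
    let ?X' = "on_obj F ?X" and ?Y' = "on_obj F ?Y"
    let ?g = "on_mor G X Y g"
    have oX: "?X \<in> Obj C" "?Y \<in> Obj C" using X Y by (auto intro: G_obj)
    have oX': "?X' \<in> Obj D" "?Y' \<in> Obj D" using oX by (auto intro: F_obj)
    have oX'': "on_obj G ?X' \<in> Obj C" "on_obj G ?Y' \<in> Obj C" using oX' by (auto intro: G_obj)
    have g': "?g \<in> Hom C ?X ?Y" by (rule G_mor[OF X Y g])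
    have Fg: "on_mor F ?X ?Y ?g \<in> Hom D ?X' ?Y'" by (rule F_mor[OF oX g'])
    show "Comp D ?X' ?Y' Y (\<epsilon> Y) (on_mor F ?X ?Y ?g) \<in> Hom D ?X' Y"
      by (rule Comp_in_Hom[OF D oX' Y Fg eps_Hom[OF Y]])
    show "Comp D ?X' X Y g (\<epsilon> X) \<in> Hom D ?X' Y"
      by (rule Comp_in_Hom[OF D oX'(1) X Y eps_Hom[OF X] g])
    let ?eX = "on_mor G ?X' X (\<epsilon> X)" and ?eY = "on_mor G ?Y' Y (\<epsilon> Y)"
    have eX: "?eX \<in> Hom C (on_obj G ?X') ?X" by (rule G_mor[OF oX'(1) X eps_Hom[OF X]])
    have eY: "?eY \<in> Hom C (on_obj G ?Y') ?Y" by (rule G_mor[OF oX'(2) Y eps_Hom[OF Y]])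
    note GFg = GF_mor[OF oX g']
    have l: "Comp C ?X (on_obj G ?X') ?Y
        (Comp C (on_obj G ?X') (on_obj G ?Y') ?Y ?eY (?GFm ?X ?Y ?g)) (\<eta> ?X) = ?g"
    proof -
      have "Comp C ?X (on_obj G ?X') ?Y
          (Comp C (on_obj G ?X') (on_obj G ?Y') ?Y ?eY (?GFm ?X ?Y ?g)) (\<eta> ?X) =
          Comp C ?X (on_obj G ?Y') ?Y ?eY
            (Comp C ?X (on_obj G ?X') (on_obj G ?Y') (?GFm ?X ?Y ?g) (\<eta> ?X))"
        by (rule Comp_assoc[OF C oX(1) oX'' oX(2) eta_Hom[OF oX(1)] GFg eY])
      also have "\<dots> = Comp C ?X (on_obj G ?Y') ?Y ?eY (Comp C ?X ?Y (on_obj G ?Y') (\<eta> ?Y) ?g)"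
        by (simp only: nat[OF oX g'])
      also have "\<dots> = Comp C ?X ?Y ?Y (Comp C ?Y (on_obj G ?Y') ?Y ?eY (\<eta> ?Y)) ?g"
        by (rule Comp_assoc[OF C oX oX''(2) oX(2) g' eta_Hom[OF oX(2)] eY, symmetric])
      also have "\<dots> = ?g" by (simp add: eps_left[OF Y] Comp_Id_left[OF C oX g'])
      finally show ?thesis .
    qed
    have r: "Comp C ?X (on_obj G ?X') ?Y (Comp C (on_obj G ?X') ?X ?Y ?g ?eX) (\<eta> ?X) = ?g"
      by (simp add: Comp_assoc[OF C oX(1) oX''(1) oX eta_Hom[OF oX(1)] eX g'] eps_left[OF X]
          Comp_Id_right[OF C oX g'])
    have "Comp C (on_obj G ?X') (on_obj G ?Y') ?Y ?eY (?GFm ?X ?Y ?g) =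
        Comp C (on_obj G ?X') ?X ?Y ?g ?eX"
      by (rule iso_right_cancel[OF C oX(1) oX''(1) oX(2) iso[OF oX(1)]])
        (auto simp: l r Comp_in_Hom[OF C oX'' oX(2) GFg eY] Comp_in_Hom[OF C oX''(1) oX eX g'])
    then show "on_mor G ?X' Y (Comp D ?X' ?Y' Y (\<epsilon> Y) (on_mor F ?X ?Y ?g)) =
        on_mor G ?X' Y (Comp D ?X' X Y g (\<epsilon> X))"
      by (simp add: G_Comp[OF oX' Y Fg eps_Hom[OF Y]] G_Comp[OF oX'(1) X Y eps_Hom[OF X] g])
  qed (intro X Y G_obj F_obj)+
  then have "is_natural_iso D D (comp_functor F G) id_functor \<epsilon>"
    using eps_iso by (auto simp: is_natural_iso_def id_functor_def comp_functor_def)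
  with F G eta show ?thesis
    unfolding is_equivalence_with_inverse_def by blast
qed


section \<open>Successors in finite linear orders\<close>

lemma linear_order_onD:
  assumes "linear_order_on A r"
  shows linear_order_field: "(x, y) \<in> r \<Longrightarrow> x \<in> A \<and> y \<in> A"
    and linear_order_refl: "x \<in> A \<Longrightarrow> (x, x) \<in> r"
    and linear_order_trans: "(x, y) \<in> r \<Longrightarrow> (y, z) \<in> r \<Longrightarrow> (x, z) \<in> r"
    and linear_order_antisym: "(x, y) \<in> r \<Longrightarrow> (y, x) \<in> r \<Longrightarrow> x = y"
    and linear_order_total: "x \<in> A \<Longrightarrow> y \<in> A \<Longrightarrow> (x, y) \<in> r \<or> (y, x) \<in> r"
proof -
  have sub: "r \<subseteq> A \<times> A" and re: "refl_on A r" and tr: "trans r" and an: "antisym r" and to: "total_on A r"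
    using assms by (simp_all add: order_on_defs)
  show "(x, y) \<in> r \<Longrightarrow> x \<in> A \<and> y \<in> A" using sub by auto
  show *: "x \<in> A \<Longrightarrow> (x, x) \<in> r" using re by (simp add: refl_on_def)
  show "(x, y) \<in> r \<Longrightarrow> (y, z) \<in> r \<Longrightarrow> (x, z) \<in> r" using tr by (rule transD)
  show "(x, y) \<in> r \<Longrightarrow> (y, x) \<in> r \<Longrightarrow> x = y" using an by (rule antisymD)
  show "x \<in> A \<Longrightarrow> y \<in> A \<Longrightarrow> (x, y) \<in> r \<or> (y, x) \<in> r" using to * by (cases "x = y") (auto simp: total_on_def)
qed

lemma is_succ_field:
  assumes "linear_order_on A r" "is_succ r x y" shows "x \<in> A" "y \<in> A"
  using linear_order_field[OF assms(1)] assms(2) by (auto simp: is_succ_def)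

lemma pre_eq:
  assumes r: "linear_order_on A r" and xy: "is_succ r x y"
  shows "pre r y = x"
  unfolding pre_def
proof (rule the_equality)
  show "is_succ r x y" by (rule xy)
next
  fix z assume z: "is_succ r z y"
  show "z = x"
    using linear_order_total[OF r is_succ_field(1)[OF r xy] is_succ_field(1)[OF r z]] xy z
    by (auto simp: is_succ_def)
qed

lemma is_succ_unique_right:
  assumes r: "linear_order_on A r" and "is_succ r x y" "is_succ r x z"
  shows "y = z"
  using linear_order_total[OF r is_succ_field(2)[OF r assms(2)] is_succ_field(2)[OF r assms(3)]] assms(2,3)
  by (auto simp: is_succ_def)

text \<open>
  In an infinite order there might be no last element before \<open>b\<close>; finiteness lets one move \<open>a\<close> up
  towards \<open>b\<close> until nothing is left in between.
\<close>

lemma ex_predecessor: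
  assumes r: "linear_order_on A r" and A: "finite A" and ab: "(a, b) \<in> r" "a \<noteq> b"
  shows "\<exists>c. is_succ r c b \<and> (a, c) \<in> r"
  using ab
proof (induction "card {c. (a, c) \<in> r \<and> (c, b) \<in> r}" arbitrary: a rule: less_induct)
  case less
  show ?case
  proof (cases "is_succ r a b")
    case True
    then show ?thesis using linear_order_refl[OF r] linear_order_field[OF r less.prems(1)] by auto
  next
    case False
    then obtain z where z: "(a, z) \<in> r" "(z, b) \<in> r" "z \<noteq> a" "z \<noteq> b"
      using less.prems by (auto simp: is_succ_def)
    have "finite {c. (a, c) \<in> r \<and> (c, b) \<in> r}"
      by (rule finite_subset[OF _ A]) (use linear_order_field[OF r] in auto)
    moreover have "{c. (z, c) \<in> r \<and> (c, b) \<in> r} \<subset> {c. (a, c) \<in> r \<and> (c, b) \<in> r}"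
    proof (rule psubsetI)
      show "{c. (z, c) \<in> r \<and> (c, b) \<in> r} \<subseteq> {c. (a, c) \<in> r \<and> (c, b) \<in> r}"
        using linear_order_trans[OF r z(1)] by auto
      have "(z, a) \<notin> r" using z linear_order_antisym[OF r z(1)] by auto
      moreover have "(a, a) \<in> r" using less.prems(1) linear_order_field[OF r] linear_order_refl[OF r] by auto
      ultimately show "{c. (z, c) \<in> r \<and> (c, b) \<in> r} \<noteq> {c. (a, c) \<in> r \<and> (c, b) \<in> r}"
        using less.prems(1) by blast
    qed
    ultimately have "card {c. (z, c) \<in> r \<and> (c, b) \<in> r} < card {c. (a, c) \<in> r \<and> (c, b) \<in> r}"
      by (rule psubset_card_mono)
    from less.hyps[OF this z(2,4)] show ?thesis using linear_order_trans[OF r z(1)] by auto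
  qed
qed

lemma is_succ_pre:
  assumes r: "linear_order_on A r" and A: "finite A" and b: "b \<in> non_first A r"
  shows "is_succ r (pre r b) b"
proof -
  obtain a where "a \<in> A" "(b, a) \<notin> r" using b by (auto simp: non_first_def)
  with b have "(a, b) \<in> r" "a \<noteq> b"
    using linear_order_total[OF r] linear_order_refl[OF r] by (auto simp: non_first_def)
  from ex_predecessor[OF r A this] show ?thesis using pre_eq[OF r] by auto
qed

lemma is_succ_iff:
  assumes r: "linear_order_on A r" and A: "finite A"
  shows "is_succ r a b \<longleftrightarrow> b \<in> non_first A r \<and> a = pre r b"
proof
  assume ab: "is_succ r a b"
  then have "(b, a) \<notin> r" using linear_order_antisym[OF r] by (auto simp: is_succ_def)
  then show "b \<in> non_first A r \<and> a = pre r b"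
    using pre_eq[OF r ab] is_succ_field[OF r ab] by (auto simp: non_first_def)
qed (use is_succ_pre[OF r A] in auto)

lemma linear_order_succ_chain:
  assumes r: "linear_order_on A r" and A: "finite A" and ab: "(a, b) \<in> r"
  shows "(a, b) \<in> {(x, y). is_succ r x y}\<^sup>*"
  using ab
proof (induction "card {c. (c, b) \<in> r}" arbitrary: b rule: less_induct)
  case less
  show ?case
  proof (cases "a = b")
    case False
    obtain c where c: "is_succ r c b" "(a, c) \<in> r" using ex_predecessor[OF r A less.prems False] by blast
    have "finite {d. (d, b) \<in> r}"
      by (rule finite_subset[OF _ A]) (use linear_order_field[OF r] in auto)
    moreover have "{d. (d, c) \<in> r} \<subset> {d. (d, b) \<in> r}"
    proof (rule psubsetI)
      have cb: "(c, b) \<in> r" "c \<noteq> b" using c(1) by (auto simp: is_succ_def)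
      show "{d. (d, c) \<in> r} \<subseteq> {d. (d, b) \<in> r}" using linear_order_trans[OF r _ cb(1)] by auto
      have "(b, c) \<notin> r" using cb linear_order_antisym[OF r cb(1)] by auto
      moreover have "(b, b) \<in> r" using less.prems(1) linear_order_field[OF r] linear_order_refl[OF r] by auto
      ultimately show "{d. (d, c) \<in> r} \<noteq> {d. (d, b) \<in> r}" by blast
    qed
    ultimately have "card {d. (d, c) \<in> r} < card {d. (d, b) \<in> r}"
      by (rule psubset_card_mono)
    from less.hyps[OF this c(2)] c(1) show ?thesis by (auto intro: rtrancl_into_rtrancl)
  qed simp
qed

section \<open>The category of ordinal graphs\<close>

text \<open>
  The objects of \<open>OGraph\<close>, of all dimensions. Nonemptiness of \<open>A\<close> excludes a second representation
  of the empty graph, and the last condition is also imposed outside \<open>A\<close>, where it makes the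
  edge-objects empty.
\<close>

primrec ordinal :: "'u ograph \<Rightarrow> bool" where
  "ordinal EmptyOGraph \<longleftrightarrow> True"
| "ordinal (MkOGraph A r E) \<longleftrightarrow>
     A \<noteq> {} \<and> finite A \<and> linear_order_on A r \<and> (\<forall>x y. ordinal (E x y)) \<and>
     (\<forall>x y. E x y \<noteq> EmptyOGraph \<longleftrightarrow> is_succ r x y)"

primrec ohom :: "'u ograph \<Rightarrow> 'u ograph \<Rightarrow> 'u graph_mor set" where
  "ohom EmptyOGraph H = {EmptyMor}"
| "ohom (MkOGraph A r E) H =
     {mor_of A f F | f F. (\<forall>x\<in>A. f x \<in> OOb H) \<and>
        (\<forall>x\<in>A. \<forall>y\<in>A. F x y \<in> ohom (E x y) (oedge H (f x) (f y)))}"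

primrec oid :: "'u ograph \<Rightarrow> 'u graph_mor" where
  "oid EmptyOGraph = EmptyMor"
| "oid (MkOGraph A r E) = mor_of A (\<lambda>x. x) (\<lambda>x y. oid (E x y))"

primrec ocomp :: "'u ograph \<Rightarrow> 'u graph_mor \<Rightarrow> 'u graph_mor \<Rightarrow> 'u graph_mor" where
  "ocomp EmptyOGraph g f = EmptyMor"
| "ocomp (MkOGraph A r E) g f = mor_of A (\<lambda>x. ob_map g (ob_map f x))
     (\<lambda>x y. ocomp (E x y) (edge_mor g (ob_map f x) (ob_map f y)) (edge_mor f x y))"

lemma Ob_underlying [simp]: "Ob (underlying G) = OOb G"
  by (cases G) auto

lemma edge_underlying [simp]: "edge (underlying G) x y = underlying (oedge G x y)"
  by (cases G) auto

lemma ob_map_mor_of: "x \<in> A \<Longrightarrow> ob_map (mor_of A f F) x = f x"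
  by (auto simp: mor_of_def)

lemma edge_mor_mor_of: "x \<in> A \<Longrightarrow> y \<in> A \<Longrightarrow> edge_mor (mor_of A f F) x y = F x y"
  by (auto simp: mor_of_def)

lemma mor_of_cong:
  "(\<And>x. x \<in> A \<Longrightarrow> f x = g x) \<Longrightarrow> (\<And>x y. x \<in> A \<Longrightarrow> y \<in> A \<Longrightarrow> F x y = K x y) \<Longrightarrow>
   mor_of A f F = mor_of A g K"
  by (auto simp: mor_of_def fun_eq_iff)

lemma MkGraph_in_enriched_graphs:
  assumes "MkGraph A E \<in> Obj (enriched_graphs V)" "x \<in> A" "y \<in> A"
  shows "E x y \<in> Obj V"
  using assms by (auto simp: enriched_graphs_def graph_of_def split: if_splits)

text \<open>
  A morphism with nonempty domain is determined by its object map and edge components, so these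
  projections can replace the existential quantifiers in the recursion for \<open>ohom\<close>.
\<close>

lemma ohom_Mk_iff:
  "g \<in> ohom (MkOGraph A r E) H \<longleftrightarrow> (\<forall>x\<in>A. ob_map g x \<in> OOb H) \<and>
     (\<forall>x\<in>A. \<forall>y\<in>A. edge_mor g x y \<in> ohom (E x y) (oedge H (ob_map g x) (ob_map g y))) \<and>
     g = mor_of A (ob_map g) (edge_mor g)"
proof
  assume "g \<in> ohom (MkOGraph A r E) H"
  then obtain f F where *: "g = mor_of A f F" "\<forall>x\<in>A. f x \<in> OOb H"
    "\<forall>x\<in>A. \<forall>y\<in>A. F x y \<in> ohom (E x y) (oedge H (f x) (f y))" by auto
  have "g = mor_of A (ob_map g) (edge_mor g)"
    unfolding *(1) by (rule mor_of_cong) (auto simp: ob_map_mor_of edge_mor_mor_of)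
  with * show "(\<forall>x\<in>A. ob_map g x \<in> OOb H) \<and>
     (\<forall>x\<in>A. \<forall>y\<in>A. edge_mor g x y \<in> ohom (E x y) (oedge H (ob_map g x) (ob_map g y))) \<and>
     g = mor_of A (ob_map g) (edge_mor g)"
    by (simp add: ob_map_mor_of edge_mor_mor_of)
qed auto

text \<open>
  At every level, hom-sets, identities and composites are computed by recursion on the domain. This
  recursion does not mention the level, so it describes all the categories \<open>GraphCat n\<close> at once.
\<close>

lemma GraphCat_underlying:
  assumes "underlying G \<in> Obj (GraphCat n)"
  shows "Hom (GraphCat n) (underlying G) (underlying H) = ohom G H"
    and "Id (GraphCat n) (underlying G) = oid G"
    and "Comp (GraphCat n) (underlying G) H' K g f = ocomp G g f"
  using assms
proof (induction n arbitrary: G H H' K g f)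
  case 0
  { case 1 then show ?case by (cases G) auto }
  { case 2 then show ?case by (cases G) auto }
  { case 3 then show ?case by (cases G) auto }
next
  case (Suc n)
  have edges: "underlying (E x y) \<in> Obj (GraphCat n)"
    if "underlying (MkOGraph A r E) \<in> Obj (GraphCat (Suc n))" "x \<in> A" "y \<in> A" for A r E x y
    using MkGraph_in_enriched_graphs[of A "\<lambda>x y. underlying (E x y)" "GraphCat n" x y] that by simp
  { case 1
    show ?case
    proof (cases G)
      case EmptyOGraph
      then show ?thesis by (auto simp: enriched_graphs_def mor_of_def)
    next
      case (MkOGraph A r E)
      with 1 have "\<forall>x\<in>A. \<forall>y\<in>A. \<forall>H. Hom (GraphCat n) (underlying (E x y)) (underlying H) = ohom (E x y) H"
        by (intro ballI allI Suc.IH(1) edges[of A r E]) simp_all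
      then have "((\<forall>x\<in>A. f x \<in> OOb H) \<and> (\<forall>x\<in>A. \<forall>y\<in>A. F x y \<in> Hom (GraphCat n)
            (underlying (E x y)) (underlying (oedge H (f x) (f y))))) \<longleftrightarrow>
          ((\<forall>x\<in>A. f x \<in> OOb H) \<and> (\<forall>x\<in>A. \<forall>y\<in>A. F x y \<in> ohom (E x y) (oedge H (f x) (f y))))" for f F
        by simp
      then show ?thesis by (simp add: MkOGraph enriched_graphs_def)
    qed }
  { case 2
    show ?case
    proof (cases G)
      case EmptyOGraph
      then show ?thesis by (auto simp: enriched_graphs_def mor_of_def)
    next
      case (MkOGraph A r E)
      have "Id (GraphCat n) (underlying (E x y)) = oid (E x y)" if "x \<in> A" "y \<in> A" for x y
        by (intro Suc.IH(2) edges[of A r E]) (use 2 MkOGraph that in simp_all)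
      then show ?thesis by (auto simp: MkOGraph enriched_graphs_def intro!: mor_of_cong)
    qed }
  { case 3
    show ?case
    proof (cases G)
      case EmptyOGraph
      then show ?thesis by (auto simp: enriched_graphs_def mor_of_def)
    next
      case (MkOGraph A r E)
      have "Comp (GraphCat n) (underlying (E x y)) H' K g f = ocomp (E x y) g f"
        if "x \<in> A" "y \<in> A" for x y H' K g f
        by (intro Suc.IH(3) edges[of A r E]) (use 3 MkOGraph that in simp_all)
      then show ?thesis by (auto simp: MkOGraph enriched_graphs_def intro!: mor_of_cong)
    qed }
qed

lemma underlying_ograph_of: "underlying (ograph_of A r E) = graph_of A (\<lambda>x y. underlying (E x y))"
  by (auto simp: ograph_of_def graph_of_def fun_eq_iff)

lemma ordinal_graphs_underlying:
  assumes "G \<in> Obj (ordinal_graphs U V)"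
  shows "underlying G \<in> Obj (enriched_graphs V)"
proof -
  obtain A r E where G: "G = ograph_of A r E" and "\<forall>x\<in>A. \<forall>y\<in>A. E x y \<in> U \<and> underlying (E x y) \<in> Obj V"
    using assms by (auto simp: ordinal_graphs_def)
  then show ?thesis unfolding G underlying_ograph_of enriched_graphs_def
    by (auto intro!: exI[of _ A] exI[of _ "\<lambda>x y. underlying (E x y)"])
qed

lemma OGraphCat_eq_ordinal_graphs: "\<exists>U. OGraphCat n = ordinal_graphs U (GraphCat n)"
  by (cases n) auto

lemma underlying_in_GraphCat:
  fixes G :: "'u ograph"
  assumes "G \<in> Obj (OGraphCat n)"
  shows "underlying G \<in> Obj (GraphCat (Suc n))"
proof -
  obtain U :: "'u ograph set" where "OGraphCat n = ordinal_graphs U (GraphCat n)"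
    using OGraphCat_eq_ordinal_graphs by blast
  with assms ordinal_graphs_underlying show ?thesis by auto
qed

lemma
  fixes G :: "'u ograph"
  assumes G: "G \<in> Obj (OGraphCat n)"
  shows OGraphCat_Hom: "Hom (OGraphCat n) G H = ohom G H"
    and OGraphCat_Id: "Id (OGraphCat n) G = oid G"
    and OGraphCat_Comp: "Comp (OGraphCat n) G H K g f = ocomp G g f"
proof -
  obtain U :: "'u ograph set" where U: "OGraphCat n = ordinal_graphs U (GraphCat n)"
    using OGraphCat_eq_ordinal_graphs by blast
  show "Hom (OGraphCat n) G H = ohom G H" "Id (OGraphCat n) G = oid G"
    "Comp (OGraphCat n) G H K g f = ocomp G g f"
    using GraphCat_underlying[OF underlying_in_GraphCat[OF G]] by (simp_all add: U ordinal_graphs_def)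
qed

lemma ordinal_ograph_of:
  assumes "finite A" "linear_order_on A r" "\<And>x y. x \<in> A \<Longrightarrow> y \<in> A \<Longrightarrow> ordinal (E x y)"
    and "\<And>x y. x \<in> A \<Longrightarrow> y \<in> A \<Longrightarrow> E x y \<noteq> EmptyOGraph \<longleftrightarrow> is_succ r x y"
  shows "ordinal (ograph_of A r E)"
  using assms is_succ_field[OF assms(2)] by (auto simp: ograph_of_def)

lemma OGraphCat_ordinal: "G \<in> Obj (OGraphCat n) \<Longrightarrow> ordinal G"
proof (induction n arbitrary: G)
  case 0
  then show ?case by (auto simp: ordinal_graphs_def intro!: ordinal_ograph_of)
next
  case (Suc n)
  from Suc.prems obtain A r E where G: "G = ograph_of A r E" "finite A" "linear_order_on A r"
      "\<forall>x\<in>A. \<forall>y\<in>A. E x y \<in> Obj (OGraphCat n)"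
      "\<forall>x\<in>A. \<forall>y\<in>A. E x y \<noteq> EmptyOGraph \<longleftrightarrow> is_succ r x y"
    by (auto simp: ordinal_graphs_def)
  show ?case unfolding G(1) using G(2-5) Suc.IH by (intro ordinal_ograph_of) blast+
qed

text \<open>
  An ordinal graph has finitely many edge-objects, and so a bound on their dimensions. Claiming
  membership from some dimension on, rather than in one dimension, makes the induction work without
  comparing the categories \<open>OGraphCat n\<close> with each other.
\<close>

lemma ordinal_in_OGraphCat: "ordinal G \<Longrightarrow> \<exists>n. \<forall>m\<ge>n. G \<in> Obj (OGraphCat m)"
proof (induction G)
  case EmptyOGraph
  have "EmptyOGraph \<in> Obj (OGraphCat m)" for m
    by (cases m) (auto simp: ordinal_graphs_def ograph_of_def order_on_defs refl_on_def trans_def antisym_def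
      intro!: exI[of _ "{}"])
  then show ?case by blast
next
  case (MkOGraph A r E)
  then have A: "A \<noteq> {}" "finite A" "linear_order_on A r" "\<And>x y. ordinal (E x y)"
    "\<And>x y. E x y \<noteq> EmptyOGraph \<longleftrightarrow> is_succ r x y" by auto
  have "\<exists>n. \<forall>m\<ge>n. E x y \<in> Obj (OGraphCat m)" for x y
    using MkOGraph.IH[of "E x" "E x y"] A(4) by auto
  then obtain b where b: "\<And>x y m. m \<ge> b x y \<Longrightarrow> E x y \<in> Obj (OGraphCat m)"
    by metis
  define N where "N = Max ((\<lambda>(x, y). b x y) ` (A \<times> A))"
  have bN: "b x y \<le> N" if "x \<in> A" "y \<in> A" for x y
    unfolding N_def by (rule Max_ge) (use that A(2) in auto)
  have "MkOGraph A r E \<in> Obj (OGraphCat m)" if m: "m \<ge> Suc N" for m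
  proof -
    obtain k where k: "m = Suc k" "k \<ge> N" using m by (cases m) auto
    have E: "E x y \<in> Obj (OGraphCat k)" if "x \<in> A" "y \<in> A" for x y
      using b[of x y k] bN[OF that] k(2) by linarith
    have "E x y = EmptyOGraph" if "\<not> (x \<in> A \<and> y \<in> A)" for x y
      using that A(5) is_succ_field[OF A(3), of x y] by blast
    then have "MkOGraph A r E = ograph_of A r E"
      using A(1) by (auto simp: ograph_of_def fun_eq_iff)
    moreover have "\<forall>x\<in>A. \<forall>y\<in>A. E x y \<in> Obj (OGraphCat k) \<and> underlying (E x y) \<in> Obj (GraphCat (Suc k))"
      using E underlying_in_GraphCat by blast
    ultimately have "\<exists>A' r' E'. MkOGraph A r E = ograph_of A' r' E' \<and> finite A' \<and> linear_order_on A' r' \<and>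
        (\<forall>x\<in>A'. \<forall>y\<in>A'. E' x y \<in> Obj (OGraphCat k) \<and> underlying (E' x y) \<in> Obj (GraphCat (Suc k))) \<and>
        (\<forall>x\<in>A'. \<forall>y\<in>A'. E' x y \<noteq> EmptyOGraph \<longleftrightarrow> is_succ r' x y)"
      using A(2,3,5) by blast
    then show ?thesis by (simp add: k(1) ordinal_graphs_def)
  qed
  then show ?case by blast
qed

lemma OGraph_Obj: "Obj OGraph = {G. ordinal G}"
proof
  show "Obj OGraph \<subseteq> {G. ordinal G}"
    using OGraphCat_ordinal by (auto simp: OGraph_def union_category_def)
  show "{G. ordinal G} \<subseteq> Obj OGraph"
    using ordinal_in_OGraphCat by (fastforce simp: OGraph_def union_category_def)
qed

lemma OGraph_Hom:
  assumes "ordinal G" "ordinal H"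
  shows "Hom OGraph G H = ohom G H"
proof -
  obtain n k where "\<forall>m\<ge>n. G \<in> Obj (OGraphCat m)" "\<forall>m\<ge>k. H \<in> Obj (OGraphCat m)"
    using assms ordinal_in_OGraphCat by blast
  then have "G \<in> Obj (OGraphCat (max n k))" "H \<in> Obj (OGraphCat (max n k))" by auto
  then show ?thesis by (auto simp: OGraph_def union_category_def OGraphCat_Hom)
qed

lemma OGraph_Id:
  assumes "ordinal G"
  shows "Id OGraph G = oid G"
proof -
  have "\<exists>n. G \<in> Obj (OGraphCat n)" using ordinal_in_OGraphCat[OF assms] by blast
  then have "G \<in> Obj (OGraphCat (LEAST n. G \<in> Obj (OGraphCat n)))" by (rule LeastI_ex)
  then show ?thesis by (simp add: OGraph_def union_category_def OGraphCat_Id)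
qed

lemma OGraph_Comp:
  assumes "ordinal G" "ordinal H" "ordinal K"
  shows "Comp OGraph G H K g f = ocomp G g f"
proof -
  let ?P = "\<lambda>n. G \<in> Obj (OGraphCat n) \<and> H \<in> Obj (OGraphCat n) \<and> K \<in> Obj (OGraphCat n)"
  obtain n k l where "\<forall>m\<ge>n. G \<in> Obj (OGraphCat m)" "\<forall>m\<ge>k. H \<in> Obj (OGraphCat m)"
    "\<forall>m\<ge>l. K \<in> Obj (OGraphCat m)"
    using assms ordinal_in_OGraphCat by metis
  then have "?P (max n (max k l))" by auto
  then have "?P (LEAST n. ?P n)" by (rule LeastI)
  then show ?thesis by (simp add: OGraph_def union_category_def OGraphCat_Comp)
qed

lemma oid_in_ohom: "oid G \<in> ohom G G"
proof (induction G)
  case (MkOGraph A r E)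
  have "oid (E x y) \<in> ohom (E x y) (E x y)" for x y
    using MkOGraph.IH[of "E x" "E x y"] by auto
  then show ?case
    by (auto intro!: exI[of _ "\<lambda>x. x"] exI[of _ "\<lambda>x y. oid (E x y)"])
qed simp

lemma ohom_MkD:
  assumes "g \<in> ohom G H"
  shows ohom_ob: "x \<in> OOb G \<Longrightarrow> ob_map g x \<in> OOb H"
    and ohom_edge: "x \<in> OOb G \<Longrightarrow> y \<in> OOb G \<Longrightarrow>
      edge_mor g x y \<in> ohom (oedge G x y) (oedge H (ob_map g x) (ob_map g y))"
proof -
  show "x \<in> OOb G \<Longrightarrow> ob_map g x \<in> OOb H"
    using assms by (cases G) (auto simp: ohom_Mk_iff simp del: ohom.simps(2))
  show "x \<in> OOb G \<Longrightarrow> y \<in> OOb G \<Longrightarrow>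
      edge_mor g x y \<in> ohom (oedge G x y) (oedge H (ob_map g x) (ob_map g y))"
    using assms by (cases G) (auto simp: ohom_Mk_iff simp del: ohom.simps(2))
qed

lemma ocomp_in_ohom:
  "f \<in> ohom G H \<Longrightarrow> g \<in> ohom H K \<Longrightarrow> ocomp G g f \<in> ohom G K"
proof (induction G arbitrary: H K f g)
  case (MkOGraph A r E)
  have IH: "ocomp (E x y) g' f' \<in> ohom (E x y) K'"
    if "f' \<in> ohom (E x y) H'" "g' \<in> ohom H' K'" for x y f' g' H' K'
    using MkOGraph.IH[of "E x" "E x y"] that by auto
  note f = ohom_ob[OF MkOGraph.prems(1)] ohom_edge[OF MkOGraph.prems(1)]
  note g = ohom_ob[OF MkOGraph.prems(2)] ohom_edge[OF MkOGraph.prems(2)]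
  have "ocomp (E x y) (edge_mor g (ob_map f x) (ob_map f y)) (edge_mor f x y)
     \<in> ohom (E x y) (oedge K (ob_map g (ob_map f x)) (ob_map g (ob_map f y)))" if "x \<in> A" "y \<in> A" for x y
    by (rule IH[OF _ g(2)]) (use f that in auto)
  moreover have "ob_map g (ob_map f x) \<in> OOb K" if "x \<in> A" for x
    using f(1) g(1) that by auto
  ultimately show ?case by (simp only: ohom.simps ocomp.simps) blast
qed simp

lemma ocomp_oid_right: "f \<in> ohom G H \<Longrightarrow> ocomp G f (oid G) = f"
proof (induction G arbitrary: H f)
  case (MkOGraph A r E)
  have f: "f = mor_of A (ob_map f) (edge_mor f)"
    using MkOGraph.prems unfolding ohom_Mk_iff by blast
  have "ocomp (E x y) (edge_mor f x y) (oid (E x y)) = edge_mor f x y" if "x \<in> A" "y \<in> A" for x y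
    using MkOGraph.IH[of "E x" "E x y"] ohom_edge[OF MkOGraph.prems, of x y] that by auto
  then have "ocomp (MkOGraph A r E) f (oid (MkOGraph A r E)) = mor_of A (ob_map f) (edge_mor f)"
    by (auto intro!: mor_of_cong simp: ob_map_mor_of edge_mor_mor_of)
  with f show ?case by simp
qed simp

lemma ocomp_oid_left: "f \<in> ohom G H \<Longrightarrow> ocomp G (oid H) f = f"
proof (induction G arbitrary: H f)
  case (MkOGraph A r E)
  have f: "f = mor_of A (ob_map f) (edge_mor f)"
    using MkOGraph.prems unfolding ohom_Mk_iff by blast
  have ob: "ob_map (oid H) x = x" if "x \<in> OOb H" for x
    using that by (cases H) (auto simp: ob_map_mor_of)
  have ed: "edge_mor (oid H) x y = oid (oedge H x y)" if "x \<in> OOb H" "y \<in> OOb H" for x y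
    using that by (cases H) (auto simp: edge_mor_mor_of)
  have "ocomp (E x y) (oid (oedge H (ob_map f x) (ob_map f y))) (edge_mor f x y) = edge_mor f x y"
    if "x \<in> A" "y \<in> A" for x y
    using MkOGraph.IH[of "E x" "E x y"] ohom_edge[OF MkOGraph.prems, of x y] that by auto
  moreover have "ob_map f x \<in> OOb H" if "x \<in> A" for x
    using ohom_ob[OF MkOGraph.prems] that by simp
  ultimately have "ocomp (MkOGraph A r E) (oid H) f = mor_of A (ob_map f) (edge_mor f)"
    by (auto intro!: mor_of_cong simp: ob ed)
  with f show ?case by simp
qed simp

lemma ocomp_assoc:
  "f \<in> ohom G H \<Longrightarrow> g \<in> ohom H K \<Longrightarrow> ocomp G (ocomp H h g) f = ocomp G h (ocomp G g f)"
proof (induction G arbitrary: H K f g h)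
  case (MkOGraph A r E)
  have IH: "ocomp (E x y) (ocomp H' h' g') f' = ocomp (E x y) h' (ocomp (E x y) g' f')"
    if "f' \<in> ohom (E x y) H'" "g' \<in> ohom H' K'" for x y f' g' h' H' K'
    using MkOGraph.IH[of "E x" "E x y"] that by auto
  have ob: "ob_map (ocomp H h g) x = ob_map h (ob_map g x)" if "x \<in> OOb H" for x
    using that by (cases H) (auto simp: ob_map_mor_of)
  have ed: "edge_mor (ocomp H h g) x y = ocomp (oedge H x y)
      (edge_mor h (ob_map g x) (ob_map g y)) (edge_mor g x y)" if "x \<in> OOb H" "y \<in> OOb H" for x y
    using that by (cases H) (auto simp: edge_mor_mor_of)
  note f = ohom_ob[OF MkOGraph.prems(1)] ohom_edge[OF MkOGraph.prems(1)]
  note g = ohom_edge[OF MkOGraph.prems(2)]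
  have *: "ocomp (E x y) (ocomp (oedge H (ob_map f x) (ob_map f y)) h'
        (edge_mor g (ob_map f x) (ob_map f y))) (edge_mor f x y) =
      ocomp (E x y) h' (ocomp (E x y) (edge_mor g (ob_map f x) (ob_map f y)) (edge_mor f x y))"
    if "x \<in> A" "y \<in> A" for x y h'
    by (rule IH[OF _ g]) (use f that in auto)
  have ob': "ob_map f x \<in> OOb H" if "x \<in> A" for x using f(1) that by simp
  show ?case by (auto intro!: mor_of_cong simp: ob ed ob' * ob_map_mor_of edge_mor_mor_of)
qed simp

lemma is_category_OGraph: "is_category OGraph"
  unfolding is_category_def
proof (intro conjI ballI)
  fix W X Y Z :: "'a ograph" and f g h
  assume W: "W \<in> Obj OGraph" and X: "X \<in> Obj OGraph" and Y: "Y \<in> Obj OGraph" and Z: "Z \<in> Obj OGraph"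
    and f: "f \<in> Hom OGraph W X" and g: "g \<in> Hom OGraph X Y" and h: "h \<in> Hom OGraph Y Z"
  then show "Comp OGraph W X Z (Comp OGraph X Y Z h g) f = Comp OGraph W Y Z h (Comp OGraph W X Y g f)"
    by (auto simp: OGraph_Obj OGraph_Hom OGraph_Comp intro: ocomp_assoc)
qed (auto simp: OGraph_Obj OGraph_Hom OGraph_Id OGraph_Comp
    intro: oid_in_ohom ocomp_in_ohom ocomp_oid_left ocomp_oid_right)

section \<open>Globular cardinals\<close>

lemma globular_setD:
  assumes "is_globular_set X"
  shows src_in: "x \<in> lev X (Suc n) \<Longrightarrow> src X n x \<in> lev X n"
    and tgt_in: "x \<in> lev X (Suc n) \<Longrightarrow> tgt X n x \<in> lev X n"
    and src_src: "x \<in> lev X (Suc (Suc n)) \<Longrightarrow> src X n (tgt X (Suc n) x) = src X n (src X (Suc n) x)"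
    and tgt_tgt: "x \<in> lev X (Suc (Suc n)) \<Longrightarrow> tgt X n (src X (Suc n) x) = tgt X n (tgt X (Suc n) x)"
  using assms by (auto simp: is_globular_set_def PiE_iff)

lemma Hom_GlobCard_iff:
  "f \<in> Hom GlobCard X Y \<longleftrightarrow> (\<forall>n. f n \<in> lev X n \<rightarrow>\<^sub>E lev Y n) \<and>
     (\<forall>n. \<forall>x\<in>lev X (Suc n). f n (src X n x) = src Y n (f (Suc n) x) \<and>
        f n (tgt X n x) = tgt Y n (f (Suc n) x))"
  by (simp add: GlobCard_def GlobSet_def)

lemma GlobCard_simps [simp]:
  "Obj GlobCard = {X. is_globular_cardinal X}"
  "Id GlobCard = (\<lambda>X n. \<lambda>x\<in>lev X n. x)"
  "Comp GlobCard = (\<lambda>X Y Z g f n. \<lambda>x\<in>lev X n. g n (f n x))"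
  by (simp_all add: GlobCard_def GlobSet_def)

lemma Hom_GlobCardD:
  assumes "f \<in> Hom GlobCard X Y"
  shows mor_in: "x \<in> lev X n \<Longrightarrow> f n x \<in> lev Y n"
    and mor_src: "x \<in> lev X (Suc n) \<Longrightarrow> f n (src X n x) = src Y n (f (Suc n) x)"
    and mor_tgt: "x \<in> lev X (Suc n) \<Longrightarrow> f n (tgt X n x) = tgt Y n (f (Suc n) x)"
    and mor_ext: "restrict (f n) (lev X n) = f n"
  using assms by (auto simp: Hom_GlobCard_iff PiE_iff extensional_restrict)

lemma cardinal_globular_set: "is_globular_cardinal X \<Longrightarrow> is_globular_set X"
  by (simp add: is_globular_cardinal_def)

lemma is_category_GlobCard: "is_category (GlobCard :: ('u gset, 'u gset_mor) category)"
  unfolding is_category_def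
proof (intro conjI ballI)
  fix W X Y Z :: "'u gset" and f g h :: "'u gset_mor"
  assume "f \<in> Hom GlobCard W X" "g \<in> Hom GlobCard X Y" "h \<in> Hom GlobCard Y Z"
  then show "Comp GlobCard W X Z (Comp GlobCard X Y Z h g) f = Comp GlobCard W Y Z h (Comp GlobCard W X Y g f)"
    by (auto simp: fun_eq_iff restrict_def mor_in)
next
  fix X Y Z :: "'u gset" and f g :: "'u gset_mor"
  assume X: "X \<in> Obj GlobCard" and f: "f \<in> Hom GlobCard X Y" and g: "g \<in> Hom GlobCard Y Z"
  then show "Comp GlobCard X Y Z g f \<in> Hom GlobCard X Z"
    by (auto simp: Hom_GlobCard_iff PiE_iff cardinal_globular_set src_in tgt_in)
next
  fix X Y :: "'u gset" and f :: "'u gset_mor"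
  assume X: "X \<in> Obj GlobCard" "Y \<in> Obj GlobCard" and f: "f \<in> Hom GlobCard X Y"
  have "(\<lambda>n. restrict (f n) (lev X n)) = f" using mor_ext[OF f] by auto
  moreover have "(\<lambda>n. \<lambda>x\<in>lev X n. f n ((\<lambda>x\<in>lev X n. x) x)) = (\<lambda>n. restrict (f n) (lev X n))"
    "(\<lambda>n. \<lambda>x\<in>lev X n. (\<lambda>x\<in>lev Y n. x) (f n x)) = (\<lambda>n. restrict (f n) (lev X n))"
    using mor_in[OF f] by (auto simp: fun_eq_iff restrict_def)
  ultimately show "Comp GlobCard X X Y f (Id GlobCard X) = f" "Comp GlobCard X Y Y (Id GlobCard Y) f = f"
    by simp_all
qed (auto simp: Hom_GlobCard_iff cardinal_globular_set src_in tgt_in)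

lemma is_iso_GlobCardI:
  assumes X: "is_globular_set X" and f: "f \<in> Hom GlobCard X Y"
    and bij: "\<And>n. bij_betw (f n) (lev X n) (lev Y n)"
  shows "is_iso GlobCard X Y f"
proof -
  define g where "g n = restrict (inv_into (lev X n) (f n)) (lev Y n)" for n
  have gf: "g n (f n x) = x" if "x \<in> lev X n" for n x
    using that bij[of n] mor_in[OF f that] by (simp add: g_def bij_betw_def)
  have fg: "f n (g n y) = y" "g n y \<in> lev X n" if "y \<in> lev Y n" for n y
    using that bij[of n] by (auto simp: g_def bij_betw_def inv_into_into f_inv_into_f)
  have "g \<in> Hom GlobCard Y X"
    unfolding Hom_GlobCard_iff
  proof (intro conjI allI ballI)
    show "g n \<in> lev Y n \<rightarrow>\<^sub>E lev X n" for n using fg(2) by (auto simp: g_def)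
    fix n y assume y: "y \<in> lev Y (Suc n)"
    define x where "x = g (Suc n) y"
    have x: "x \<in> lev X (Suc n)" "y = f (Suc n) x" using fg y by (auto simp: x_def)
    show "g n (src Y n y) = src X n (g (Suc n) y)" "g n (tgt Y n y) = tgt X n (g (Suc n) y)"
      by (simp_all add: x gf src_in[OF X x(1)] tgt_in[OF X x(1)]
          flip: mor_src[OF f x(1)] mor_tgt[OF f x(1)])
  qed
  moreover have "Comp GlobCard X Y X g f = Id GlobCard X" "Comp GlobCard Y X Y f g = Id GlobCard Y"
    using gf fg by (auto simp: fun_eq_iff restrict_def)
  ultimately show ?thesis using f by (auto simp: is_iso_def)
qed

text \<open>
  Iterated source and target of a cell, down to level \<open>0\<close>. They locate the cell in the linear order
  of the vertices of level \<open>0\<close>.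
\<close>

primrec base_src :: "'u gset \<Rightarrow> nat \<Rightarrow> 'u \<Rightarrow> 'u" where
  "base_src X 0 x = x"
| "base_src X (Suc n) x = base_src X n (src X n x)"

primrec base_tgt :: "'u gset \<Rightarrow> nat \<Rightarrow> 'u \<Rightarrow> 'u" where
  "base_tgt X 0 x = x"
| "base_tgt X (Suc n) x = base_tgt X n (tgt X n x)"

lemma base_src_in: "is_globular_set X \<Longrightarrow> x \<in> lev X n \<Longrightarrow> base_src X n x \<in> lev X 0"
  by (induction n arbitrary: x) (auto simp: src_in)

lemma base_tgt_in: "is_globular_set X \<Longrightarrow> x \<in> lev X n \<Longrightarrow> base_tgt X n x \<in> lev X 0"
  by (induction n arbitrary: x) (auto simp: tgt_in)

lemma base_src_tgt:
  "is_globular_set X \<Longrightarrow> x \<in> lev X (Suc (Suc n)) \<Longrightarrow>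
   base_src X (Suc n) (tgt X (Suc n) x) = base_src X (Suc (Suc n)) x"
  by (simp add: src_src)

lemma base_tgt_src:
  "is_globular_set X \<Longrightarrow> x \<in> lev X (Suc (Suc n)) \<Longrightarrow>
   base_tgt X (Suc n) (src X (Suc n) x) = base_tgt X (Suc (Suc n)) x"
  by (simp add: tgt_tgt)

lemma mor_base_src:
  assumes X: "is_globular_set X" and f: "f \<in> Hom GlobCard X Y"
  shows "x \<in> lev X n \<Longrightarrow> f 0 (base_src X n x) = base_src Y n (f n x)"
  by (induction n arbitrary: x) (auto simp: src_in[OF X] mor_src[OF f])

lemma mor_base_tgt:
  assumes X: "is_globular_set X" and f: "f \<in> Hom GlobCard X Y"
  shows "x \<in> lev X n \<Longrightarrow> f 0 (base_tgt X n x) = base_tgt Y n (f n x)"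
  by (induction n arbitrary: x) (auto simp: tgt_in[OF X] mor_tgt[OF f])

lemma prec_src: "x \<in> lev X (Suc n) \<Longrightarrow> ((n, src X n x), (Suc n, x)) \<in> prec X"
  and prec_tgt: "x \<in> lev X (Suc n) \<Longrightarrow> ((Suc n, x), (n, tgt X n x)) \<in> prec X"
  by (auto simp: prec_def)

lemma base_src_path: "is_globular_set X \<Longrightarrow> x \<in> lev X n \<Longrightarrow> ((0, base_src X n x), (n, x)) \<in> (prec X)\<^sup>*"
proof (induction n arbitrary: x)
  case (Suc n)
  show ?case
    using rtrancl_into_rtrancl[OF Suc.IH[OF Suc.prems(1) src_in[OF Suc.prems]] prec_src[OF Suc.prems(2)]]
    by simp
qed simp

lemma base_tgt_path: "is_globular_set X \<Longrightarrow> x \<in> lev X n \<Longrightarrow> ((n, x), (0, base_tgt X n x)) \<in> (prec X)\<^sup>*"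
proof (induction n arbitrary: x)
  case (Suc n)
  show ?case
    using converse_rtrancl_into_rtrancl[OF prec_tgt[OF Suc.prems(2)] Suc.IH[OF Suc.prems(1) tgt_in[OF Suc.prems]]]
    by simp
qed simp

lemma vertices_iff: "(n, x) \<in> vertices X \<longleftrightarrow> x \<in> lev X n"
  by (auto simp: vertices_def)

lemma prec_vertices:
  assumes "is_globular_set X" "(p, q) \<in> prec X"
  shows "p \<in> vertices X" "q \<in> vertices X"
  using assms by (auto simp: prec_def vertices_iff src_in tgt_in)

lemma rtrancl_prec_vertices:
  assumes X: "is_globular_set X" and "(p, q) \<in> (prec X)\<^sup>*" and "p \<in> vertices X"
  shows "q \<in> vertices X"
  using assms(2,3) by (induction rule: rtrancl_induct) (auto dest: prec_vertices[OF X])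

text \<open>
  A step of \<open>prec\<close> between vertices of positive level keeps the iterated source and target. So a path
  either stays at positive level, and then is a path in a restriction, or it meets level \<open>0\<close>, for the
  first time at the iterated target of its first vertex and for the last time at the iterated source
  of its last one.
\<close>

lemma prec_path_cases:
  assumes X: "is_globular_set X" and path: "((m, x), q) \<in> (prec X)\<^sup>*" and x: "x \<in> lev X m"
  shows "(m, x) = q \<or>
    ((0, base_tgt X m x), (0, base_src X (fst q) (snd q))) \<in> (prec X)\<^sup>* \<or>
    (\<exists>m' n' y. m = Suc m' \<and> q = (Suc n', y) \<and> base_src X (Suc n') y = base_src X m x \<and>
       base_tgt X (Suc n') y = base_tgt X m x \<and>
       ((m', x), (n', y)) \<in> (prec (restr X (base_src X m x) (base_tgt X m x)))\<^sup>*)"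
  (is "?P q \<or> ?Q q \<or> ?R q")
  using path
proof (induction rule: rtrancl_induct)
  case base
  then show ?case by simp
next
  case (step q q')
  have q: "q \<in> vertices X" using rtrancl_prec_vertices[OF X step(1)] x by (simp add: vertices_iff)
  have in_restr: "y \<in> restr_lev X (base_src X (Suc n) y) (base_tgt X (Suc n) y) n"
    if "y \<in> lev X (Suc n)" for n y
    using base_src_path[OF X that] base_tgt_path[OF X that] base_src_in[OF X that] base_tgt_in[OF X that] that
    by (simp add: restr_lev_def tri_def vertices_iff del: base_src.simps base_tgt.simps)
  consider
    (up) b where "q = (0, src X 0 b)" "q' = (1, b)" "b \<in> lev X 1"
  | (down) b where "q = (1, b)" "q' = (0, tgt X 0 b)" "b \<in> lev X 1"
  | (fibre) k b k' b' where "q = (Suc k, b)" "q' = (Suc k', b')" "b \<in> lev X (Suc k)"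
      "base_src X (Suc k') b' = base_src X (Suc k) b" "base_tgt X (Suc k') b' = base_tgt X (Suc k) b"
      "((k, b), (k', b')) \<in> prec (restr X (base_src X (Suc k) b) (base_tgt X (Suc k) b))"
  proof -
    from step(2) consider n b where "q = (n, src X n b)" "q' = (Suc n, b)" "b \<in> lev X (Suc n)"
      | n b where "q = (Suc n, b)" "q' = (n, tgt X n b)" "b \<in> lev X (Suc n)"
      by (auto simp: prec_def)
    then show thesis
    proof cases
      case (1 n b)
      show ?thesis
      proof (cases n)
        case 0
        then show ?thesis using 1 up by auto
      next
        case (Suc k)
        have b: "b \<in> lev X (Suc (Suc k))" using 1 Suc by simp
        have eq: "base_src X (Suc (Suc k)) b = base_src X (Suc k) (src X (Suc k) b)"
          "base_tgt X (Suc (Suc k)) b = base_tgt X (Suc k) (src X (Suc k) b)"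
          using base_tgt_src[OF X b] by simp_all
        have "((k, src X (Suc k) b), (Suc k, b)) \<in>
            prec (restr X (base_src X (Suc (Suc k)) b) (base_tgt X (Suc (Suc k)) b))"
          using prec_src[of b "restr X (base_src X (Suc (Suc k)) b) (base_tgt X (Suc (Suc k)) b)" k]
            in_restr[OF b] by (simp add: restr_def)
        then show ?thesis
          using fibre[of k "src X (Suc k) b" "Suc k" b] 1 Suc eq src_in[OF X b] by simp
      qed
    next
      case (2 n b)
      show ?thesis
      proof (cases n)
        case 0
        then show ?thesis using 2 down by auto
      next
        case (Suc k)
        have b: "b \<in> lev X (Suc (Suc k))" using 2 Suc by simp
        have eq: "base_tgt X (Suc k) (tgt X (Suc k) b) = base_tgt X (Suc (Suc k)) b"
          "base_src X (Suc k) (tgt X (Suc k) b) = base_src X (Suc (Suc k)) b"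
          using base_src_tgt[OF X b] by simp_all
        have "((Suc k, b), (k, tgt X (Suc k) b)) \<in>
            prec (restr X (base_src X (Suc (Suc k)) b) (base_tgt X (Suc (Suc k)) b))"
          using prec_tgt[of b "restr X (base_src X (Suc (Suc k)) b) (base_tgt X (Suc (Suc k)) b)" k]
            in_restr[OF b] by (simp add: restr_def)
        then show ?thesis
          using fibre[of "Suc k" b k "tgt X (Suc k) b"] 2 Suc eq b
          by (simp del: base_src.simps base_tgt.simps)
      qed
    qed
  qed
  then show ?case
  proof cases
    case up
    have e: "base_src X (fst q') (snd q') = base_src X (fst q) (snd q)" using up by simp
    from step.IH show ?thesis
    proof (elim disjE)
      assume "?P q" then show ?thesis unfolding e using up by simp
    next
      assume "?Q q" then show ?thesis unfolding e by simp
    next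
      assume "?R q" then show ?thesis using up by simp
    qed
  next
    case down
    have e: "((0, base_src X (fst q) (snd q)), (0, base_src X (fst q') (snd q'))) \<in> (prec X)\<^sup>*"
      using prec_src[of b X 0] prec_tgt[of b X 0] down by auto
    from step.IH show ?thesis
    proof (elim disjE)
      assume "?P q" then show ?thesis using down by auto
    next
      assume "?Q q" then show ?thesis using e by (auto intro: rtrancl_trans)
    next
      assume "?R q" then show ?thesis using down by auto
    qed
  next
    case fibre
    have e: "base_src X (fst q') (snd q') = base_src X (fst q) (snd q)" using fibre by simp
    from step.IH show ?thesis
    proof (elim disjE)
      assume "?P q" then show ?thesis using fibre by (auto simp del: base_src.simps base_tgt.simps)
    next
      assume "?Q q" then show ?thesis unfolding e by simp
    next
      assume "?R q"
      then have "?R q'" using fibre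
        by (auto simp del: base_src.simps base_tgt.simps intro: rtrancl_into_rtrancl)
      then show ?thesis by blast
    qed
  qed
qed

lemma path_from_level0:
  assumes X: "is_globular_set X" and "((0, w), (n, x)) \<in> (prec X)\<^sup>*" "w \<in> lev X 0"
  shows "((0, w), (0, base_src X n x)) \<in> (prec X)\<^sup>*"
  using prec_path_cases[OF assms(1,2,3)] by auto

lemma path_to_level0:
  assumes X: "is_globular_set X" and "((n, x), (0, w)) \<in> (prec X)\<^sup>*" "x \<in> lev X n"
  shows "((0, base_tgt X n x), (0, w)) \<in> (prec X)\<^sup>*"
  using prec_path_cases[OF assms(1,2,3)] by auto

lemma linear_order_triI:
  assumes X: "is_globular_set X"
    and "\<And>p q. \<lbrakk>p \<in> vertices X; q \<in> vertices X; (p, q) \<in> (prec X)\<^sup>*; (q, p) \<in> (prec X)\<^sup>*\<rbrakk> \<Longrightarrow> p = q"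
    and "\<And>p q. \<lbrakk>p \<in> vertices X; q \<in> vertices X\<rbrakk> \<Longrightarrow> (p, q) \<in> (prec X)\<^sup>* \<or> (q, p) \<in> (prec X)\<^sup>*"
  shows "linear_order_on (vertices X) (tri X)"
  unfolding order_on_defs
proof (intro conjI)
  show "trans (tri X)" by (auto simp: trans_def tri_def)
  show "antisym (tri X)" using assms(2) unfolding antisym_def tri_def by blast
  show "total_on (vertices X) (tri X)" using assms(3) unfolding total_on_def tri_def by blast
qed (auto simp: tri_def refl_on_def)

lemma cardinalD:
  assumes "is_globular_cardinal X"
  shows cardinal_antisym: "\<lbrakk>p \<in> vertices X; q \<in> vertices X; (p, q) \<in> (prec X)\<^sup>*; (q, p) \<in> (prec X)\<^sup>*\<rbrakk> \<Longrightarrow> p = q"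
    and cardinal_total: "\<lbrakk>p \<in> vertices X; q \<in> vertices X\<rbrakk> \<Longrightarrow> (p, q) \<in> (prec X)\<^sup>* \<or> (q, p) \<in> (prec X)\<^sup>*"
proof -
  have r: "linear_order_on (vertices X) (tri X)" using assms by (simp add: is_globular_cardinal_def)
  show "p = q" if "p \<in> vertices X" "q \<in> vertices X" "(p, q) \<in> (prec X)\<^sup>*" "(q, p) \<in> (prec X)\<^sup>*"
    using linear_order_antisym[OF r, of p q] that by (simp add: tri_def)
  show "(p, q) \<in> (prec X)\<^sup>* \<or> (q, p) \<in> (prec X)\<^sup>*" if "p \<in> vertices X" "q \<in> vertices X"
    using linear_order_total[OF r, of p q] that by (auto simp: tri_def)
qed

lemma order0_iff: "(x, y) \<in> order0 X \<longleftrightarrow> x \<in> lev X 0 \<and> y \<in> lev X 0 \<and> ((0, x), (0, y)) \<in> (prec X)\<^sup>*"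
  by (auto simp: order0_def tri_def vertices_iff)

lemma linear_order_order0:
  assumes X: "is_globular_cardinal X"
  shows "linear_order_on (lev X 0) (order0 X)"
  unfolding order_on_defs
proof (intro conjI)
  show "trans (order0 X)" by (auto simp: trans_def order0_iff)
  show "antisym (order0 X)"
    using cardinal_antisym[OF X] by (fastforce simp: antisym_def order0_iff vertices_iff)
  show "total_on (lev X 0) (order0 X)"
    using cardinal_total[OF X] by (simp add: total_on_def order0_iff vertices_iff)
qed (auto simp: order0_iff refl_on_def)

lemma finite_lev:
  assumes "is_globular_cardinal X" shows "finite (lev X n)"
proof -
  have "Pair n ` lev X n \<subseteq> vertices X" by (auto simp: vertices_iff)
  then have "finite (Pair n ` lev X n)"
    using assms by (auto simp: is_globular_cardinal_def intro: finite_subset)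
  then show ?thesis by (rule finite_imageD) (auto simp: inj_on_def)
qed

text \<open>
  Linearity decides on which side of a \<open>1\<close>-cell a vertex of level \<open>0\<close> lies, and a path between
  the two passes through an end of the cell. So no vertex lies strictly between the ends.
\<close>

lemma is_succ_order0_src_tgt:
  assumes X: "is_globular_cardinal X" and x: "x \<in> lev X 1"
  shows "is_succ (order0 X) (src X 0 x) (tgt X 0 x)"
proof -
  have X': "is_globular_set X" using X by (rule cardinal_globular_set)
  let ?s = "src X 0 x" and ?t = "tgt X 0 x"
  have sx: "((0, ?s), (1, x)) \<in> prec X" and xt: "((1, x), (0, ?t)) \<in> prec X"
    using prec_src[of x X 0] prec_tgt[of x X 0] x by auto
  have lev: "?s \<in> lev X 0" "?t \<in> lev X 0" using src_in[OF X'] tgt_in[OF X'] x by auto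
  have r: "linear_order_on (lev X 0) (order0 X)" by (rule linear_order_order0[OF X])
  have "?s \<noteq> ?t"
  proof
    assume "?s = ?t"
    then have "(0 :: nat, ?s) = (1, x)"
      using sx xt lev x by (intro cardinal_antisym[OF X]) (auto simp: vertices_iff)
    then show False by simp
  qed
  moreover have "w = ?s \<or> w = ?t" if "(?s, w) \<in> order0 X" "(w, ?t) \<in> order0 X" for w
  proof -
    have w: "w \<in> lev X 0" using that by (simp add: order0_iff)
    then have "((0, w), (1, x)) \<in> (prec X)\<^sup>* \<or> ((1, x), (0, w)) \<in> (prec X)\<^sup>*"
      using cardinal_total[OF X, of "(0, w)" "(1, x)"] x by (simp add: vertices_iff)
    then have "(w, ?s) \<in> order0 X \<or> (?t, w) \<in> order0 X"
      using path_from_level0[OF X', of w 1 x] path_to_level0[OF X', of 1 x w] w x lev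
      by (auto simp: order0_iff)
    then show ?thesis using that linear_order_antisym[OF r] by blast
  qed
  ultimately show ?thesis using sx xt lev by (auto simp: is_succ_def order0_iff)
qed

text \<open>
  A path from \<open>y\<close> to \<open>z\<close> can leave \<open>y\<close> only into a \<open>1\<close>-cell with source \<open>y\<close>. The target of that cell
  lies weakly before \<open>z\<close>, and cannot lie before it when \<open>z\<close> is the successor of \<open>y\<close>.
\<close>

lemma is_succ_order0_iff:
  assumes X: "is_globular_cardinal X"
  shows "is_succ (order0 X) y z \<longleftrightarrow> (\<exists>x\<in>lev X 1. src X 0 x = y \<and> tgt X 0 x = z)"
proof
  assume yz: "is_succ (order0 X) y z"
  have X': "is_globular_set X" using X by (rule cardinal_globular_set)
  have "((0, y), (0, z)) \<in> (prec X)\<^sup>*" "y \<noteq> z" using yz by (auto simp: is_succ_def order0_iff)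
  then obtain q where q: "((0, y), q) \<in> prec X" "(q, (0, z)) \<in> (prec X)\<^sup>*"
    by (metis converse_rtranclE prod.inject)
  then obtain x where x: "q = (1, x)" "x \<in> lev X 1" "src X 0 x = y" by (auto simp: prec_def)
  have t: "is_succ (order0 X) y (tgt X 0 x)" using is_succ_order0_src_tgt[OF X x(2)] x(3) by simp
  have "((0, tgt X 0 x), (0, z)) \<in> (prec X)\<^sup>*" using path_to_level0[OF X' q(2)[unfolded x(1)] x(2)] by simp
  then have "(tgt X 0 x, z) \<in> order0 X"
    using yz t by (auto simp: is_succ_def order0_iff)
  then have "tgt X 0 x = y \<or> tgt X 0 x = z" using yz t by (auto simp: is_succ_def)
  then have "tgt X 0 x = z" using t by (auto simp: is_succ_def)
  then show "\<exists>x\<in>lev X 1. src X 0 x = y \<and> tgt X 0 x = z" using x by blast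
qed (use is_succ_order0_src_tgt[OF X] in auto)

lemma is_succ_base:
  assumes X: "is_globular_cardinal X"
  shows "x \<in> lev X (Suc n) \<Longrightarrow> is_succ (order0 X) (base_src X (Suc n) x) (base_tgt X (Suc n) x)"
proof (induction n arbitrary: x)
  case 0
  then show ?case using is_succ_order0_src_tgt[OF X, of x] by simp
next
  case (Suc n)
  have X': "is_globular_set X" using X by (rule cardinal_globular_set)
  show ?case
    using Suc.IH[OF src_in[OF X' Suc.prems]] base_tgt_src[OF X' Suc.prems] by simp
qed

text \<open>
  The order relations that define the restriction amount to equations between iterated sources and
  targets, which are what source, target and morphisms visibly preserve.
\<close>

lemma restr_lev_eq:
  assumes X: "is_globular_cardinal X" and yz: "is_succ (order0 X) y z"
  shows "restr_lev X y z n = {x \<in> lev X (Suc n). base_src X (Suc n) x = y \<and> base_tgt X (Suc n) x = z}"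
proof (intro set_eqI iffI)
  have X': "is_globular_set X" using X by (rule cardinal_globular_set)
  have r: "linear_order_on (lev X 0) (order0 X)" by (rule linear_order_order0[OF X])
  fix x
  { assume "x \<in> restr_lev X y z n"
    then have x: "x \<in> lev X (Suc n)" and p: "((0, y), (Suc n, x)) \<in> (prec X)\<^sup>*"
      "((Suc n, x), (0, z)) \<in> (prec X)\<^sup>*" "y \<in> lev X 0" "z \<in> lev X 0"
      by (auto simp: restr_lev_def tri_def vertices_iff)
    let ?s = "base_src X (Suc n) x" and ?t = "base_tgt X (Suc n) x"
    have st: "is_succ (order0 X) ?s ?t" by (rule is_succ_base[OF X x])
    have ys: "(y, ?s) \<in> order0 X" and tz: "(?t, z) \<in> order0 X"
      using path_from_level0[OF X' p(1,3)] path_to_level0[OF X' p(2) x] p(3,4)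
        base_src_in[OF X' x] base_tgt_in[OF X' x] by (simp_all add: order0_iff)
    have st': "(?s, ?t) \<in> order0 X" "?s \<noteq> ?t" using st by (auto simp: is_succ_def)
    have "?s = y \<or> ?s = z"
      using yz ys linear_order_trans[OF r st'(1) tz] by (auto simp: is_succ_def)
    moreover have "?s \<noteq> z" using linear_order_antisym[OF r st'(1)] tz st'(2) by metis
    ultimately have "?s = y" by blast
    moreover have "?t = z" using is_succ_unique_right[OF r yz] st calculation by simp
    ultimately show "x \<in> {x \<in> lev X (Suc n). base_src X (Suc n) x = y \<and> base_tgt X (Suc n) x = z}"
      using x by simp }
  { assume "x \<in> {x \<in> lev X (Suc n). base_src X (Suc n) x = y \<and> base_tgt X (Suc n) x = z}"
    then have x: "x \<in> lev X (Suc n)" "base_src X (Suc n) x = y" "base_tgt X (Suc n) x = z" by auto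
    show "x \<in> restr_lev X y z n"
      using base_src_path[OF X' x(1)] base_tgt_path[OF X' x(1)] base_src_in[OF X' x(1)] base_tgt_in[OF X' x(1)]
      unfolding x(2,3) by (simp add: restr_lev_def tri_def vertices_iff x(1)) }
qed

lemma restr_simps:
  "lev (restr X y z) n = restr_lev X y z n"
  "x \<in> restr_lev X y z (Suc n) \<Longrightarrow> src (restr X y z) n x = src X (Suc n) x"
  "x \<in> restr_lev X y z (Suc n) \<Longrightarrow> tgt (restr X y z) n x = tgt X (Suc n) x"
  by (simp_all add: restr_def)

lemma is_globular_set_restr:
  assumes X: "is_globular_cardinal X" and yz: "is_succ (order0 X) y z"
  shows "is_globular_set (restr X y z)"
proof -
  have X': "is_globular_set X" using X by (rule cardinal_globular_set)
  have in_restr: "src X (Suc n) x \<in> restr_lev X y z n" "tgt X (Suc n) x \<in> restr_lev X y z n"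
    if "x \<in> restr_lev X y z (Suc n)" for n x
  proof -
    have x: "x \<in> lev X (Suc (Suc n))" "base_src X (Suc (Suc n)) x = y" "base_tgt X (Suc (Suc n)) x = z"
      using that restr_lev_eq[OF X yz] by auto
    then show "src X (Suc n) x \<in> restr_lev X y z n" "tgt X (Suc n) x \<in> restr_lev X y z n"
      unfolding restr_lev_eq[OF X yz]
      using src_in[OF X' x(1)] tgt_in[OF X' x(1)] base_src_tgt[OF X' x(1)] base_tgt_src[OF X' x(1)]
      by auto
  qed
  have "x \<in> lev X (Suc (Suc (Suc n)))" if "x \<in> restr_lev X y z (Suc (Suc n))" for x n
    using that by (simp add: restr_lev_def)
  then show ?thesis
    using in_restr src_src[OF X'] tgt_tgt[OF X']
    by (auto simp: is_globular_set_def restr_def)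
qed

text \<open>
  The relation \<open>tri\<close> of the restriction is that of \<open>X\<close>: a path of \<open>X\<close> between two cells of the restriction
  that left it would lead from \<open>z\<close> back to \<open>y\<close>.
\<close>

lemma is_globular_cardinal_restr:
  assumes X: "is_globular_cardinal X" and yz: "is_succ (order0 X) y z"
  shows "is_globular_cardinal (restr X y z)"
proof -
  let ?R = "restr X y z"
  let ?s = "\<lambda>(k, x). (Suc k, x)"
  have X': "is_globular_set X" using X by (rule cardinal_globular_set)
  have R: "is_globular_set ?R" by (rule is_globular_set_restr[OF X yz])
  have r: "linear_order_on (lev X 0) (order0 X)" by (rule linear_order_order0[OF X])
  have vert: "?s p \<in> vertices X" if "p \<in> vertices ?R" for p
    using that by (cases p) (auto simp: vertices_iff restr_simps restr_lev_def)
  have fin: "finite (vertices ?R)"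
  proof (rule finite_imageD)
    show "finite (?s ` vertices ?R)"
      by (rule finite_subset[of _ "vertices X"])
        (use vert X in \<open>auto simp: is_globular_cardinal_def\<close>)
  qed (auto simp: inj_on_def)
  have lift1: "(?s p, ?s q) \<in> prec X" if "(p, q) \<in> prec ?R" for p q
    using that unfolding prec_def by (auto simp: restr_simps) (auto simp: restr_lev_def)
  have lift: "(?s p, ?s q) \<in> (prec X)\<^sup>*" if "(p, q) \<in> (prec ?R)\<^sup>*" for p q
    using that by (induction rule: rtrancl_induct) (blast intro: rtrancl_into_rtrancl lift1)+
  have unlift: "(p, q) \<in> (prec ?R)\<^sup>*"
    if pq: "(?s p, ?s q) \<in> (prec X)\<^sup>*" and pR: "p \<in> vertices ?R" and qR: "q \<in> vertices ?R" for p q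
  proof -
    obtain m x n w where [simp]: "p = (m, x)" "q = (n, w)" by (metis surj_pair)
    have x: "x \<in> lev X (Suc m)" "base_src X (Suc m) x = y" "base_tgt X (Suc m) x = z"
      and w: "w \<in> lev X (Suc n)" "base_src X (Suc n) w = y" "base_tgt X (Suc n) w = z"
      using pR qR restr_lev_eq[OF X yz] by (auto simp: vertices_iff restr_simps)
    have "((0, z), (0, y)) \<notin> (prec X)\<^sup>*"
    proof
      assume "((0, z), (0, y)) \<in> (prec X)\<^sup>*"
      then have "(z, y) \<in> order0 X" "(y, z) \<in> order0 X" "y \<noteq> z" using yz by (auto simp: is_succ_def order0_iff)
      then show False using linear_order_antisym[OF r] by blast
    qed
    then show ?thesis
      using prec_path_cases[OF X', of "Suc m" x "(Suc n, w)"] pq x w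
      by (auto simp del: base_src.simps base_tgt.simps)
  qed
  have "linear_order_on (vertices ?R) (tri ?R)"
  proof (rule linear_order_triI[OF R])
    fix p q assume p: "p \<in> vertices ?R" and q: "q \<in> vertices ?R"
    show "(p, q) \<in> (prec ?R)\<^sup>* \<or> (q, p) \<in> (prec ?R)\<^sup>*"
      using cardinal_total[OF X vert[OF p] vert[OF q]] unlift p q by blast
    assume "(p, q) \<in> (prec ?R)\<^sup>*" "(q, p) \<in> (prec ?R)\<^sup>*"
    then have "?s p = ?s q" by (intro cardinal_antisym[OF X] vert p q lift)
    then show "p = q" by (auto split: prod.splits)
  qed
  then show ?thesis using R fin by (simp add: is_globular_cardinal_def)
qed

lemma restr_nonempty:
  assumes X: "is_globular_cardinal X" and yz: "is_succ (order0 X) y z"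
  shows "lev (restr X y z) 0 \<noteq> {}"
  using yz is_succ_order0_iff[OF X] restr_lev_eq[OF X yz, of 0] by (auto simp: restr_simps)

text \<open>
  The induction on dimension that defines \<open>Gamma_obj\<close> and \<open>Gamma_mor\<close>.
\<close>

lemma cardinal_induct [consumes 1, case_names restr]:
  assumes "is_globular_cardinal X"
    and "\<And>X. is_globular_cardinal X \<Longrightarrow> (\<And>y z. is_succ (order0 X) y z \<Longrightarrow> P (restr X y z)) \<Longrightarrow> P X"
  shows "P X"
  using assms(1)
proof (induction "height X" arbitrary: X rule: less_induct)
  case less
  show ?case
  proof (rule assms(2)[OF less.prems])
    fix y z assume yz: "is_succ (order0 X) y z"
    then have "lev X 0 \<noteq> {}" by (auto simp: is_succ_def order0_iff)
    then show "P (restr X y z)"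
      by (intro less.hyps height_restr is_globular_cardinal_restr less.prems yz)
  qed
qed

lemma mor_is_succ:
  assumes X: "is_globular_cardinal X" and Y: "is_globular_cardinal Y" and f: "f \<in> Hom GlobCard X Y"
    and yz: "is_succ (order0 X) y z"
  shows "is_succ (order0 Y) (f 0 y) (f 0 z)"
proof -
  obtain x where x: "x \<in> lev X 1" "src X 0 x = y" "tgt X 0 x = z" using yz is_succ_order0_iff[OF X] by auto
  have "f 1 x \<in> lev Y 1" "src Y 0 (f 1 x) = f 0 y" "tgt Y 0 (f 1 x) = f 0 z"
    using mor_in[OF f x(1)] mor_src[OF f, of x 0] mor_tgt[OF f, of x 0] x by auto
  then show ?thesis using is_succ_order0_iff[OF Y] by auto
qed

lemma restr_mor_in:
  assumes X: "is_globular_cardinal X" and Y: "is_globular_cardinal Y" and f: "f \<in> Hom GlobCard X Y"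
    and yz: "is_succ (order0 X) y z"
  shows "restr_mor X f y z \<in> Hom GlobCard (restr X y z) (restr Y (f 0 y) (f 0 z))"
proof -
  have X': "is_globular_set X" using X by (rule cardinal_globular_set)
  note R = restr_lev_eq[OF X yz] restr_lev_eq[OF Y mor_is_succ[OF X Y f yz]]
  have in_R: "f (Suc n) x \<in> restr_lev Y (f 0 y) (f 0 z) n" if "x \<in> restr_lev X y z n" for x n
    using that mor_in[OF f] mor_base_src[OF X' f, of x "Suc n"] mor_base_tgt[OF X' f, of x "Suc n"]
    unfolding R by (auto simp del: base_src.simps base_tgt.simps)
  have G: "src X (Suc n) x \<in> restr_lev X y z n" "tgt X (Suc n) x \<in> restr_lev X y z n"
    "x \<in> lev X (Suc (Suc n))"
    if "x \<in> restr_lev X y z (Suc n)" for x n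
    using src_in[OF is_globular_set_restr[OF X yz], of x n] tgt_in[OF is_globular_set_restr[OF X yz], of x n] that
    by (auto simp: restr_simps) (auto simp: restr_lev_def)
  show ?thesis
    using in_R G mor_src[OF f] mor_tgt[OF f]
    by (auto simp: Hom_GlobCard_iff restr_simps restr_mor_def)
qed

section \<open>Suspensions\<close>

lemma inv_pair [simp]: "inj pair \<Longrightarrow> inv pair (pair v) = v"
  by (rule inv_f_f)

lemma lev_su_0: "lev (su pair X A r) 0 = A"
  by (simp add: su_def su_lev_def)

lemma lev_su_Suc: "lev (su pair X A r) (Suc n) = pair ` (SIGMA i:non_first A r. lev (X i) n)"
  by (simp add: su_def su_lev_def)

lemma pair_in_lev_su:
  "inj pair \<Longrightarrow> pair (i, x) \<in> lev (su pair X A r) (Suc n) \<longleftrightarrow> i \<in> non_first A r \<and> x \<in> lev (X i) n"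
  by (auto simp: lev_su_Suc dest: injD)

lemma src_tgt_su:
  assumes "inj pair"
  shows "i \<in> non_first A r \<Longrightarrow> x \<in> lev (X i) 0 \<Longrightarrow> src (su pair X A r) 0 (pair (i, x)) = pre r i"
    and "i \<in> non_first A r \<Longrightarrow> x \<in> lev (X i) 0 \<Longrightarrow> tgt (su pair X A r) 0 (pair (i, x)) = i"
    and "i \<in> non_first A r \<Longrightarrow> x \<in> lev (X i) (Suc n) \<Longrightarrow>
      src (su pair X A r) (Suc n) (pair (i, x)) = pair (i, src (X i) n x)"
    and "i \<in> non_first A r \<Longrightarrow> x \<in> lev (X i) (Suc n) \<Longrightarrow>
      tgt (su pair X A r) (Suc n) (pair (i, x)) = pair (i, tgt (X i) n x)"
proof -
  have in_su: "pair (i, x) \<in> su_lev pair X A r (Suc n)" if "i \<in> non_first A r" "x \<in> lev (X i) n" for n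
    using that by (auto simp: su_lev_def)
  note simps = su_def inv_pair[OF assms] restrict_apply' in_su
  show "i \<in> non_first A r \<Longrightarrow> x \<in> lev (X i) 0 \<Longrightarrow> src (su pair X A r) 0 (pair (i, x)) = pre r i"
    and "i \<in> non_first A r \<Longrightarrow> x \<in> lev (X i) 0 \<Longrightarrow> tgt (su pair X A r) 0 (pair (i, x)) = i"
    and "i \<in> non_first A r \<Longrightarrow> x \<in> lev (X i) (Suc n) \<Longrightarrow>
      src (su pair X A r) (Suc n) (pair (i, x)) = pair (i, src (X i) n x)"
    and "i \<in> non_first A r \<Longrightarrow> x \<in> lev (X i) (Suc n) \<Longrightarrow>
      tgt (su pair X A r) (Suc n) (pair (i, x)) = pair (i, tgt (X i) n x)"
    by (simp_all add: simps)
qed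

lemma in_lev_su_SucE:
  assumes "v \<in> lev (su pair X A r) (Suc n)"
  obtains i x where "v = pair (i, x)" "i \<in> non_first A r" "x \<in> lev (X i) n"
  using assms unfolding lev_su_Suc by blast

locale suspension =
  fixes pair :: "'u \<times> 'u \<Rightarrow> 'u" and X :: "'u \<Rightarrow> 'u gset" and A :: "'u set" and r :: "'u rel"
  assumes inj_pair: "inj pair"
    and lin: "linear_order_on A r" and fin: "finite A"
    and card: "i \<in> non_first A r \<Longrightarrow> is_globular_cardinal (X i)"
    and nonempty: "i \<in> non_first A r \<Longrightarrow> lev (X i) 0 \<noteq> {}"
begin

abbreviation "S \<equiv> su pair X A r"

definition emb :: "'u \<Rightarrow> nat \<times> 'u \<Rightarrow> nat \<times> 'u" where
  "emb i p = (Suc (fst p), pair (i, snd p))"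

text \<open>
  The ends of the vertices of the suspension in \<open>A\<close>: a vertex of level \<open>0\<close> is its own end, and a
  vertex of the summand \<open>i\<close> lies between the predecessor of \<open>i\<close> and \<open>i\<close>.
\<close>

definition lower :: "nat \<times> 'u \<Rightarrow> 'u" where
  "lower p = (case fst p of 0 \<Rightarrow> snd p | Suc n \<Rightarrow> pre r (fst (inv pair (snd p))))"

definition upper :: "nat \<times> 'u \<Rightarrow> 'u" where
  "upper p = (case fst p of 0 \<Rightarrow> snd p | Suc n \<Rightarrow> fst (inv pair (snd p)))"

lemma bound_simps [simp]:
  "lower (0, a) = a" "upper (0, a) = a" "lower (emb i p) = pre r i" "upper (emb i p) = i"
  by (simp_all add: lower_def upper_def emb_def inj_pair)

lemma emb_eq_iff [simp]: "emb i p = emb j q \<longleftrightarrow> i = j \<and> p = q"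
  using inj_pair by (auto simp: emb_def prod_eq_iff dest: injD)

lemma level0_neq_emb [simp]: "(0, a) \<noteq> emb i p" "emb i p \<noteq> (0, a)"
  by (simp_all add: emb_def)

lemma pre_succ: "i \<in> non_first A r \<Longrightarrow> is_succ r (pre r i) i"
  by (rule is_succ_pre[OF lin fin])

lemma pre_less:
  assumes "i \<in> non_first A r"
  shows "(pre r i, i) \<in> r" "(i, pre r i) \<notin> r" "pre r i \<in> A" "i \<in> A"
  using pre_succ[OF assms] linear_order_antisym[OF lin] linear_order_field[OF lin]
  by (auto simp: is_succ_def)

lemma is_globular_set_su: "is_globular_set S"
proof -
  have X: "is_globular_set (X i)" if "i \<in> non_first A r" for i
    using card[OF that] by (rule cardinal_globular_set)
  have "src S n v \<in> lev S n" "tgt S n v \<in> lev S n" if "v \<in> lev S (Suc n)" for n v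
  proof -
    from that obtain i x where v: "v = pair (i, x)" "i \<in> non_first A r" "x \<in> lev (X i) n"
      by (rule in_lev_su_SucE)
    have "src S n v \<in> lev S n \<and> tgt S n v \<in> lev S n"
    proof (cases n)
      case 0
      then show ?thesis using v pre_less[OF v(2)] by (simp add: src_tgt_su inj_pair lev_su_0)
    next
      case (Suc m)
      then show ?thesis using v src_in[OF X[OF v(2)], of x m] tgt_in[OF X[OF v(2)], of x m]
        by (simp add: src_tgt_su inj_pair pair_in_lev_su)
    qed
    then show "src S n v \<in> lev S n" "tgt S n v \<in> lev S n" by auto
  qed
  moreover have "src S n (src S (Suc n) v) = src S n (tgt S (Suc n) v) \<and>
      tgt S n (src S (Suc n) v) = tgt S n (tgt S (Suc n) v)" if "v \<in> lev S (Suc (Suc n))" for n v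
  proof -
    from that obtain i x where v: "v = pair (i, x)" "i \<in> non_first A r" "x \<in> lev (X i) (Suc n)"
      by (rule in_lev_su_SucE)
    note x = src_in[OF X[OF v(2)] v(3)] tgt_in[OF X[OF v(2)] v(3)]
    show ?thesis
    proof (cases n)
      case 0
      then show ?thesis using v x by (simp add: src_tgt_su inj_pair)
    next
      case (Suc m)
      then show ?thesis using v x src_src[OF X[OF v(2)], of x m] tgt_tgt[OF X[OF v(2)], of x m]
        by (simp add: src_tgt_su inj_pair)
    qed
  qed
  moreover have "src S n \<in> extensional (lev S (Suc n))" "tgt S n \<in> extensional (lev S (Suc n))" for n
    by (simp_all add: su_def)
  ultimately show ?thesis by (auto simp: is_globular_set_def PiE_iff)
qed

lemma vertices_su:
  "vertices S = Pair 0 ` A \<union> (\<Union>i\<in>non_first A r. emb i ` vertices (X i))"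
proof (intro set_eqI)
  fix p :: "nat \<times> 'u"
  obtain n v where p: "p = (n, v)" by (cases p)
  show "p \<in> vertices S \<longleftrightarrow> p \<in> Pair 0 ` A \<union> (\<Union>i\<in>non_first A r. emb i ` vertices (X i))"
  proof (cases n)
    case (Suc m)
    then have "p \<in> vertices S \<longleftrightarrow> (\<exists>i\<in>non_first A r. \<exists>x\<in>lev (X i) m. v = pair (i, x))"
      by (auto simp: p vertices_iff lev_su_Suc)
    also have "\<dots> \<longleftrightarrow> p \<in> (\<Union>i\<in>non_first A r. emb i ` vertices (X i))"
      by (force simp: p Suc emb_def vertices_iff image_iff Bex_def)
    finally show ?thesis by (auto simp: p Suc)
  qed (auto simp: p vertices_iff lev_su_0 emb_def)
qed

lemma prec_su_cases:
  assumes "(p, q) \<in> prec S"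
  obtains (up) i x where "i \<in> non_first A r" "x \<in> lev (X i) 0" "p = (0, pre r i)" "q = emb i (0, x)"
  | (down) i x where "i \<in> non_first A r" "x \<in> lev (X i) 0" "p = emb i (0, x)" "q = (0, i)"
  | (inner) i x y where "i \<in> non_first A r" "p = emb i x" "q = emb i y" "(x, y) \<in> prec (X i)"
proof -
  from assms consider n v where "p = (n, src S n v)" "q = (Suc n, v)" "v \<in> lev S (Suc n)"
    | n v where "p = (Suc n, v)" "q = (n, tgt S n v)" "v \<in> lev S (Suc n)"
    by (auto simp: prec_def)
  then show thesis
  proof cases
    case (1 n v)
    from this(3) obtain i x where v: "v = pair (i, x)" "i \<in> non_first A r" "x \<in> lev (X i) n"
      by (rule in_lev_su_SucE)
    show ?thesis
    proof (cases n)
      case 0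
      then show ?thesis using 1 v up[of i x] by (simp add: emb_def src_tgt_su inj_pair)
    next
      case (Suc m)
      then show ?thesis using 1 v inner[of i "(m, src (X i) m x)" "(Suc m, x)"] prec_src[of x "X i" m]
        by (simp add: emb_def src_tgt_su inj_pair)
    qed
  next
    case (2 n v)
    from this(3) obtain i x where v: "v = pair (i, x)" "i \<in> non_first A r" "x \<in> lev (X i) n"
      by (rule in_lev_su_SucE)
    show ?thesis
    proof (cases n)
      case 0
      then show ?thesis using 2 v down[of i x] by (simp add: emb_def src_tgt_su inj_pair)
    next
      case (Suc m)
      then show ?thesis using 2 v inner[of i "(Suc m, x)" "(m, tgt (X i) m x)"] prec_tgt[of x "X i" m]
        by (simp add: emb_def src_tgt_su inj_pair)
    qed
  qed
qed

lemma prec_su_up: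
  assumes i: "i \<in> non_first A r" and x: "x \<in> lev (X i) 0"
  shows "((0, pre r i), emb i (0, x)) \<in> prec S" "(emb i (0, x), (0, i)) \<in> prec S"
  using prec_src[of "pair (i, x)" S 0] prec_tgt[of "pair (i, x)" S 0] i x
  by (simp_all add: emb_def src_tgt_su inj_pair pair_in_lev_su)

lemma prec_su_inner:
  assumes i: "i \<in> non_first A r" and xy: "(p, q) \<in> prec (X i)"
  shows "(emb i p, emb i q) \<in> prec S"
proof -
  from xy consider n x where "p = (n, src (X i) n x)" "q = (Suc n, x)" "x \<in> lev (X i) (Suc n)"
    | n x where "p = (Suc n, x)" "q = (n, tgt (X i) n x)" "x \<in> lev (X i) (Suc n)"
    by (auto simp: prec_def)
  then show ?thesis
  proof cases
    case (1 n x)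
    then show ?thesis using prec_src[of "pair (i, x)" S "Suc n"] i
      by (simp add: emb_def src_tgt_su inj_pair pair_in_lev_su)
  next
    case (2 n x)
    then show ?thesis using prec_tgt[of "pair (i, x)" S "Suc n"] i
      by (simp add: emb_def src_tgt_su inj_pair pair_in_lev_su)
  qed
qed

lemma path_su_inner:
  assumes i: "i \<in> non_first A r" and xy: "(p, q) \<in> (prec (X i))\<^sup>*"
  shows "(emb i p, emb i q) \<in> (prec S)\<^sup>*"
  using xy by (induction rule: rtrancl_induct) (blast intro: rtrancl_into_rtrancl prec_su_inner[OF i])+

lemma path_su_bounds:
  assumes i: "i \<in> non_first A r" and p: "p \<in> vertices (X i)"
  shows "((0, pre r i), emb i p) \<in> (prec S)\<^sup>*" "(emb i p, (0, i)) \<in> (prec S)\<^sup>*"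
proof -
  obtain n x where nx: "p = (n, x)" "x \<in> lev (X i) n" using p by (cases p) (auto simp: vertices_iff)
  have X: "is_globular_set (X i)" by (rule cardinal_globular_set[OF card[OF i]])
  show "((0, pre r i), emb i p) \<in> (prec S)\<^sup>*"
    using path_su_inner[OF i base_src_path[OF X nx(2)]] prec_su_up(1)[OF i base_src_in[OF X nx(2)]]
    unfolding nx(1) by (rule converse_rtrancl_into_rtrancl[rotated])
  show "(emb i p, (0, i)) \<in> (prec S)\<^sup>*"
    using path_su_inner[OF i base_tgt_path[OF X nx(2)]] prec_su_up(2)[OF i base_tgt_in[OF X nx(2)]]
    unfolding nx(1) by (rule rtrancl_into_rtrancl)
qed

lemma path_su_level0:
  assumes ab: "(a, b) \<in> r"
  shows "((0, a), (0, b)) \<in> (prec S)\<^sup>*"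
  using linear_order_succ_chain[OF lin fin ab]
proof (induction rule: rtrancl_induct)
  case (step b c)
  then have c: "c \<in> non_first A r" "b = pre r c" using is_succ_iff[OF lin fin] by auto
  obtain x where x: "x \<in> lev (X c) 0" using nonempty[OF c(1)] by blast
  show ?case using step.IH prec_su_up[OF c(1) x] unfolding c(2) by (meson rtrancl_into_rtrancl)
qed simp

lemma vertex_bounds:
  assumes "p \<in> vertices S"
  shows "(lower p, upper p) \<in> r" "((0, lower p), p) \<in> (prec S)\<^sup>*" "(p, (0, upper p)) \<in> (prec S)\<^sup>*"
  using assms pre_less(1) linear_order_refl[OF lin] path_su_bounds by (auto simp: vertices_su)

text \<open>
  The ends place every vertex in the linear order of \<open>A\<close>. Along a path they never decrease, and a
  nontrivial path on which they stay constant lies in one summand. Any other nontrivial path passes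
  through level \<open>0\<close>, weakly after the upper end of \<open>p\<close> and weakly before the lower end of \<open>q\<close>.
\<close>

lemma path_su_cases:
  assumes "(p, q) \<in> (prec S)\<^sup>*"
  shows "p = q \<or> (upper p, lower q) \<in> r \<or>
    (\<exists>i\<in>non_first A r. \<exists>x y. p = emb i x \<and> q = emb i y \<and> (x, y) \<in> (prec (X i))\<^sup>*)"
  using assms
proof (induction rule: rtrancl_induct)
  case (step q q')
  from step(2) show ?case
  proof (cases rule: prec_su_cases)
    case (up i x)
    then show ?thesis using step.IH linear_order_refl[OF lin pre_less(3)[OF up(1)]] by auto
  next
    case (down i x)
    then show ?thesis
      using step.IH linear_order_trans[OF lin _ pre_less(1)[OF down(1)]] linear_order_refl[OF lin pre_less(4)[OF down(1)]]
      by auto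
  next
    case (inner i x y)
    have xy: "(x, y) \<in> (prec (X i))\<^sup>*" using inner(4) by simp
    from step.IH show ?thesis
    proof (elim disjE bexE exE conjE)
      assume "p = q"
      then show ?thesis using inner xy by blast
    next
      assume "(upper p, lower q) \<in> r"
      then show ?thesis using inner by simp
    next
      fix j x' y' assume "p = emb j x'" "q = emb j y'" "(x', y') \<in> (prec (X j))\<^sup>*"
      moreover from this have "j = i" "(x', y) \<in> (prec (X i))\<^sup>*"
        using inner xy by (auto intro: rtrancl_trans)
      ultimately show ?thesis using inner by blast
    qed
  qed
qed simp

text \<open>
  Two vertices with different upper ends are comparable by way of level \<open>0\<close>, as nothing in \<open>A\<close> lies
  between the two ends of a vertex. With equal upper ends, one of them is that end itself, or both are
  in the same summand, where linearity is assumed. For antisymmetry, if \<open>p\<close> and \<open>q\<close> lie on a cycle that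
  leaves the summands, then all their ends are equal, and only a vertex of level \<open>0\<close> has equal ends.
\<close>

lemma is_globular_cardinal_su: "is_globular_cardinal S"
proof -
  have "finite (vertices S)"
    unfolding vertices_su
  proof (intro finite_UnI finite_imageI finite_UN_I fin)
    show "finite (non_first A r)" using fin by (simp add: non_first_def)
    show "finite (vertices (X i))" if "i \<in> non_first A r" for i
      using card[OF that] by (simp add: is_globular_cardinal_def)
  qed
  moreover have "linear_order_on (vertices S) (tri S)"
  proof (rule linear_order_triI[OF is_globular_set_su])
    fix p q assume p: "p \<in> vertices S" and q: "q \<in> vertices S"
    have apart: "(p, q) \<in> (prec S)\<^sup>*"
      if "(upper p, upper q) \<in> r" "upper p \<noteq> upper q" "p \<in> vertices S" "q \<in> vertices S" for p q
    proof -
      from ex_predecessor[OF lin fin that(1,2)]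
      obtain c where c: "is_succ r c (upper q)" "(upper p, c) \<in> r" by blast
      have "(upper p, lower q) \<in> r"
        using that(1,4) c pre_eq[OF lin c(1)] by (auto simp: vertices_su)
      then show ?thesis
        using vertex_bounds(3)[OF that(3)] path_su_level0 vertex_bounds(2)[OF that(4)]
        by (meson rtrancl_trans)
    qed
    show "(p, q) \<in> (prec S)\<^sup>* \<or> (q, p) \<in> (prec S)\<^sup>*"
    proof (cases "upper p = upper q")
      case True
      consider "p = (0, upper p)" | "q = (0, upper q)"
        | i x y where "i \<in> non_first A r" "x \<in> vertices (X i)" "y \<in> vertices (X i)" "p = emb i x" "q = emb i y"
        using p q True by (auto simp: vertices_su)
      then show ?thesis
      proof cases
        case 1
        then show ?thesis using vertex_bounds(3)[OF q] True by simp
      next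
        case 2
        then show ?thesis using vertex_bounds(3)[OF p] True by simp
      next
        case (3 i x y)
        then show ?thesis
          using cardinal_total[OF card[OF 3(1)] 3(2,3)] path_su_inner[OF 3(1)] unfolding 3(4,5) by blast
      qed
    next
      case False
      have "upper p \<in> A" "upper q \<in> A"
        using linear_order_field[OF lin vertex_bounds(1)[OF p]] linear_order_field[OF lin vertex_bounds(1)[OF q]]
        by auto
      then show ?thesis using apart[OF _ _ p q] apart[OF _ _ q p] linear_order_total[OF lin] False by metis
    qed
    assume pq: "(p, q) \<in> (prec S)\<^sup>*" and qp: "(q, p) \<in> (prec S)\<^sup>*"
    have level0: "v = (0, lower v)" if "(upper v, lower v) \<in> r" "v \<in> vertices S" for v
      using that pre_less(2) by (auto simp: vertices_su)
    show "p = q"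
    proof (cases "p = q")
      case False
      show ?thesis
      proof (cases "(upper p, lower q) \<in> r \<and> (upper q, lower p) \<in> r")
        case True
        note pb = vertex_bounds(1)[OF p] and qb = vertex_bounds(1)[OF q]
        have pq': "(upper p, upper q) \<in> r" "(upper q, upper p) \<in> r"
          using True linear_order_trans[OF lin _ pb] linear_order_trans[OF lin _ qb] by auto
        have "p = (0, lower p)" "q = (0, lower q)"
          using level0 p q True linear_order_trans[OF lin pq'(1)] linear_order_trans[OF lin pq'(2)] by blast+
        then have "p = (0, upper p)" "q = (0, upper q)" by (metis bound_simps(2))+
        then show ?thesis using linear_order_antisym[OF lin pq'] by simp
      next
        case notboth: False
        then obtain i x y where "i \<in> non_first A r" "p = emb i x" "q = emb i y"
          using path_su_cases[OF pq] path_su_cases[OF qp] False by metis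
        moreover from this have "(upper p, lower q) \<notin> r" "(upper q, lower p) \<notin> r" using pre_less(2) by auto
        ultimately have i: "i \<in> non_first A r" "p = emb i x" "q = emb i y"
          and xy: "(x, y) \<in> (prec (X i))\<^sup>*" "(y, x) \<in> (prec (X i))\<^sup>*"
          using path_su_cases[OF pq] path_su_cases[OF qp] False by auto
        have "x \<in> vertices (X i)" "y \<in> vertices (X i)" using p q i by (auto simp: vertices_su)
        then show ?thesis using cardinal_antisym[OF card[OF i(1)] _ _ xy] i by simp
      qed
    qed
  qed
  ultimately show ?thesis using is_globular_set_su by (simp add: is_globular_cardinal_def)
qed

end

lemma (in suspension) base_su:
  assumes i: "i \<in> non_first A r"
  shows "x \<in> lev (X i) n \<Longrightarrow> base_src S (Suc n) (pair (i, x)) = pre r i"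
    and "x \<in> lev (X i) n \<Longrightarrow> base_tgt S (Suc n) (pair (i, x)) = i"
proof (induction n arbitrary: x)
  case 0
  { case 1 then show ?case using i by (simp add: src_tgt_su inj_pair) }
  { case 2 then show ?case using i by (simp add: src_tgt_su inj_pair) }
next
  case (Suc n)
  have X: "is_globular_set (X i)" by (rule cardinal_globular_set[OF card[OF i]])
  { case 1 then show ?case
      using Suc.IH(1)[OF src_in[OF X 1]] i by (simp add: src_tgt_su inj_pair) }
  { case 2 then show ?case
      using Suc.IH(2)[OF tgt_in[OF X 2]] i by (simp add: src_tgt_su inj_pair) }
qed

lemma su_mor_0: "v \<in> A \<Longrightarrow> su_mor pair X A r F f 0 v = f v"
  by (simp add: su_mor_def su_lev_def)

lemma su_mor_Suc:
  assumes "inj pair" "i \<in> non_first A r" "x \<in> lev (X i) n"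
  shows "su_mor pair X A r F f (Suc n) (pair (i, x)) = pair (f i, F i n x)"
proof -
  have "pair (i, x) \<in> su_lev pair X A r (Suc n)" using assms(2,3) by (auto simp: su_lev_def)
  then show ?thesis by (simp add: su_mor_def assms(1))
qed

lemma su_mor_extensional: "su_mor pair X A r F f n \<in> extensional (lev (su pair X A r) n)"
  by (simp add: su_mor_def su_def)

lemma su_mor_eqI:
  assumes "inj pair"
    and "\<And>v. v \<in> A \<Longrightarrow> h 0 v = f v"
    and "\<And>i x n. i \<in> non_first A r \<Longrightarrow> x \<in> lev (X i) n \<Longrightarrow> h (Suc n) (pair (i, x)) = pair (f i, F i n x)"
    and "\<And>n. h n \<in> extensional (lev (su pair X A r) n)"
  shows "su_mor pair X A r F f = h"
proof
  fix n
  show "su_mor pair X A r F f n = h n"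
  proof (rule extensionalityI[OF su_mor_extensional assms(4)])
    fix v assume v: "v \<in> lev (su pair X A r) n"
    show "su_mor pair X A r F f n v = h n v"
    proof (cases n)
      case 0
      then show ?thesis using v assms(2) by (simp add: lev_su_0 su_mor_0)
    next
      case (Suc m)
      from v[unfolded Suc] obtain i x where "v = pair (i, x)" "i \<in> non_first A r" "x \<in> lev (X i) m"
        by (rule in_lev_su_SucE)
      then show ?thesis using Suc assms(1,3) by (simp add: su_mor_Suc)
    qed
  qed
qed

lemma su_mor_in_Hom:
  assumes inj: "inj pair"
    and X: "\<And>i. i \<in> non_first A r \<Longrightarrow> is_globular_set (X i)"
    and f: "\<And>a. a \<in> A \<Longrightarrow> f a \<in> B"
    and f_succ: "\<And>i. i \<in> non_first A r \<Longrightarrow> f i \<in> non_first B q \<and> f (pre r i) = pre q (f i) \<and> pre r i \<in> A"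
    and F: "\<And>i. i \<in> non_first A r \<Longrightarrow> F i \<in> Hom GlobCard (X i) (Y (f i))"
  shows "su_mor pair X A r F f \<in> Hom GlobCard (su pair X A r) (su pair Y B q)"
proof -
  let ?S = "su pair X A r" and ?T = "su pair Y B q" and ?F = "su_mor pair X A r F f"
  have nf: "i \<in> A" if "i \<in> non_first A r" for i using that by (simp add: non_first_def)
  have "?F n v \<in> lev ?T n" if "v \<in> lev ?S n" for n v
  proof (cases n)
    case 0
    then show ?thesis using that f by (simp add: lev_su_0 su_mor_0)
  next
    case (Suc m)
    from that[unfolded Suc] obtain i x where "v = pair (i, x)" "i \<in> non_first A r" "x \<in> lev (X i) m"
      by (rule in_lev_su_SucE)
    then show ?thesis using Suc inj f_succ mor_in[OF F] by (simp add: su_mor_Suc pair_in_lev_su)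
  qed
  moreover have "?F n (src ?S n v) = src ?T n (?F (Suc n) v) \<and> ?F n (tgt ?S n v) = tgt ?T n (?F (Suc n) v)"
    if "v \<in> lev ?S (Suc n)" for n v
  proof -
    from that obtain i x where v: "v = pair (i, x)" "i \<in> non_first A r" "x \<in> lev (X i) n"
      by (rule in_lev_su_SucE)
    show ?thesis
    proof (cases n)
      case 0
      then show ?thesis using v inj f_succ[OF v(2)] mor_in[OF F[OF v(2)] v(3)] nf
        by (simp add: su_mor_Suc src_tgt_su su_mor_0)
    next
      case (Suc m)
      note x = v(3)[unfolded Suc]
      show ?thesis
        using Suc v inj f_succ[OF v(2)] mor_in[OF F[OF v(2)] x] mor_src[OF F[OF v(2)] x]
          mor_tgt[OF F[OF v(2)] x] src_in[OF X[OF v(2)] x] tgt_in[OF X[OF v(2)] x]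
        by (simp add: su_mor_Suc src_tgt_su)
    qed
  qed
  ultimately show ?thesis using su_mor_extensional[of pair X A r F f]
    by (auto simp: Hom_GlobCard_iff PiE_iff)
qed

section \<open>The functor from ordinal graphs to globular cardinals\<close>

lemma lev_Gamma'_0: "lev (Gamma'_obj pair G) 0 = OOb G"
  by (cases G) (auto simp: lev_su_0 empty_gset_def)

lemma ordinal_OOb_nonempty: "ordinal G \<Longrightarrow> G \<noteq> EmptyOGraph \<Longrightarrow> OOb G \<noteq> {}"
  by (cases G) auto

lemma is_globular_cardinal_empty: "is_globular_cardinal (empty_gset :: 'u gset)"
proof -
  let ?X = "empty_gset :: 'u gset"
  have set: "is_globular_set ?X" by (auto simp: is_globular_set_def empty_gset_def)
  have vert: "vertices ?X = {}" by (auto simp: vertices_def empty_gset_def)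
  have "linear_order_on (vertices ?X) (tri ?X)"
    by (rule linear_order_triI[OF set]) (simp_all add: vert)
  then show ?thesis by (simp add: is_globular_cardinal_def set vert)
qed

lemma ordinal_suspension:
  assumes inj: "inj pair" and G: "ordinal (MkOGraph A r E)"
    and cards: "\<And>x y. is_globular_cardinal (Gamma'_obj pair (E x y))"
  shows "suspension pair (\<lambda>x. Gamma'_obj pair (E (pre r x) x)) A r"
proof
  show "lev (Gamma'_obj pair (E (pre r i) i)) 0 \<noteq> {}" if "i \<in> non_first A r" for i
    using G is_succ_pre[OF _ _ that] ordinal_OOb_nonempty[of "E (pre r i) i"] by (simp add: lev_Gamma'_0)
qed (use assms in auto)

lemma is_globular_cardinal_Gamma':
  assumes "inj pair"
  shows "ordinal G \<Longrightarrow> is_globular_cardinal (Gamma'_obj pair G)"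
proof (induction G)
  case (MkOGraph A r E)
  have "is_globular_cardinal (Gamma'_obj pair (E x y))" for x y
    using MkOGraph.IH[of "E x" "E x y"] MkOGraph.prems by auto
  then interpret suspension pair "\<lambda>x. Gamma'_obj pair (E (pre r x) x)" A r
    by (intro ordinal_suspension assms MkOGraph.prems)
  show ?case using is_globular_cardinal_su by simp
qed (simp add: is_globular_cardinal_empty)

text \<open>
  A morphism of ordinal graphs preserves successors: there is no morphism from a nonempty to an empty
  edge-object.
\<close>

lemma ohom_is_succ:
  assumes G: "ordinal (MkOGraph A r E)" and H: "ordinal (MkOGraph B q F)"
    and g: "g \<in> ohom (MkOGraph A r E) (MkOGraph B q F)" and xy: "is_succ r x y"
  shows "is_succ q (ob_map g x) (ob_map g y)"
proof -
  have "x \<in> A" "y \<in> A" using is_succ_field[OF _ xy, of A] G by auto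
  then have "edge_mor g x y \<in> ohom (E x y) (F (ob_map g x) (ob_map g y))"
    using ohom_edge[OF g, of x y] by simp
  moreover have "OOb (E x y) \<noteq> {}" using G xy ordinal_OOb_nonempty[of "E x y"] by auto
  ultimately have "OOb (F (ob_map g x) (ob_map g y)) \<noteq> {}"
    using ohom_ob by fastforce
  then have "F (ob_map g x) (ob_map g y) \<noteq> EmptyOGraph" by auto
  then show ?thesis using H by simp
qed

lemma ohom_pre:
  assumes G: "ordinal (MkOGraph A r E)" and H: "ordinal (MkOGraph B q F)"
    and g: "g \<in> ohom (MkOGraph A r E) (MkOGraph B q F)" and i: "i \<in> non_first A r"
  shows "ob_map g i \<in> non_first B q" "pre q (ob_map g i) = ob_map g (pre r i)" "pre r i \<in> A" "i \<in> A"
    "edge_mor g (pre r i) i \<in> ohom (E (pre r i) i) (F (ob_map g (pre r i)) (ob_map g i))"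
proof -
  have s: "is_succ r (pre r i) i" using is_succ_pre[OF _ _ i] G by auto
  from ohom_is_succ[OF G H g s] show "ob_map g i \<in> non_first B q" "pre q (ob_map g i) = ob_map g (pre r i)"
    using is_succ_iff[of B q] H by auto
  show A: "pre r i \<in> A" "i \<in> A" using is_succ_field[OF _ s, of A] G by auto
  show "edge_mor g (pre r i) i \<in> ohom (E (pre r i) i) (F (ob_map g (pre r i)) (ob_map g i))"
    using ohom_edge[OF g, of "pre r i" i] A by simp
qed

lemma ohom_codomain_nonempty:
  assumes "ordinal (MkOGraph A r E)" "g \<in> ohom (MkOGraph A r E) H"
  obtains B q F where "H = MkOGraph B q F"
proof (cases H)
  case EmptyOGraph
  then show ?thesis using assms ohom_ob[OF assms(2)] by auto
qed

lemma Gamma'_mor_in_Hom: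
  assumes inj: "inj pair"
  shows "ordinal G \<Longrightarrow> ordinal H \<Longrightarrow> g \<in> ohom G H \<Longrightarrow>
    Gamma'_mor pair G g \<in> Hom GlobCard (Gamma'_obj pair G) (Gamma'_obj pair H)"
proof (induction G arbitrary: H g)
  case EmptyOGraph
  then show ?case by (auto simp: Hom_GlobCard_iff empty_gset_mor_def empty_gset_def)
next
  case (MkOGraph A r E)
  obtain B q F where H: "H = MkOGraph B q F"
    by (rule ohom_codomain_nonempty[OF MkOGraph.prems(1,3)])
  note G' = MkOGraph.prems(1) and H' = MkOGraph.prems(2)[unfolded H] and g = MkOGraph.prems(3)[unfolded H]
  have ord: "ordinal (E x y)" "ordinal (F x y)" for x y using G' H' by auto
  show ?case
    unfolding H Gamma'_mor.simps Gamma'_obj.simps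
  proof (rule su_mor_in_Hom[OF inj])
    fix i assume i: "i \<in> non_first A r"
    note gi = ohom_pre[OF G' H' g i]
    show "is_globular_set (Gamma'_obj pair (E (pre r i) i))"
      by (intro cardinal_globular_set is_globular_cardinal_Gamma' inj ord)
    show "ob_map g i \<in> non_first B q \<and> ob_map g (pre r i) = pre q (ob_map g i) \<and> pre r i \<in> A"
      using gi by simp
    show "Gamma'_mor pair (E (pre r i) i) (edge_mor g (pre r i) i) \<in> Hom GlobCard
        (Gamma'_obj pair (E (pre r i) i)) (Gamma'_obj pair (F (pre q (ob_map g i)) (ob_map g i)))"
      unfolding gi(2) using MkOGraph.IH[of "E (pre r i)" "E (pre r i) i"] ord gi(5) by auto
  qed (use ohom_ob[OF g] in auto)
qed

lemma Gamma'_mor_oid: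
  assumes inj: "inj pair"
  shows "ordinal G \<Longrightarrow> Gamma'_mor pair G (oid G) = Id GlobCard (Gamma'_obj pair G)"
proof (induction G)
  case EmptyOGraph
  then show ?case by (auto simp: fun_eq_iff empty_gset_mor_def empty_gset_def)
next
  case (MkOGraph A r E)
  let ?X = "\<lambda>x. Gamma'_obj pair (E (pre r x) x)"
  show ?case
    unfolding Gamma'_mor.simps Gamma'_obj.simps
  proof (rule su_mor_eqI[OF inj])
    fix i x n assume i: "i \<in> non_first A r" and x: "x \<in> lev (?X i) n"
    have A: "pre r i \<in> A" "i \<in> A"
      using is_succ_field[OF _ is_succ_pre[OF _ _ i], of A] MkOGraph.prems by auto
    have "Gamma'_mor pair (E (pre r i) i) (oid (E (pre r i) i)) = Id GlobCard (?X i)"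
      by (rule MkOGraph.IH[of "E (pre r i)" "E (pre r i) i"]) (use MkOGraph.prems in auto)
    then show "Id GlobCard (su pair ?X A r) (Suc n) (pair (i, x)) =
        pair (ob_map (oid (MkOGraph A r E)) i,
          Gamma'_mor pair (E (pre r i) i) (edge_mor (oid (MkOGraph A r E)) (pre r i) i) n x)"
      using i x A by (simp add: ob_map_mor_of edge_mor_mor_of pair_in_lev_su inj)
  qed (auto simp: lev_su_0 ob_map_mor_of extensional_def)
qed

lemma Gamma'_mor_ocomp:
  assumes inj: "inj pair"
  shows "ordinal G \<Longrightarrow> ordinal H \<Longrightarrow> ordinal K \<Longrightarrow> f \<in> ohom G H \<Longrightarrow> g \<in> ohom H K \<Longrightarrow>
    Gamma'_mor pair G (ocomp G g f) = Comp GlobCard (Gamma'_obj pair G) (Gamma'_obj pair H)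
      (Gamma'_obj pair K) (Gamma'_mor pair H g) (Gamma'_mor pair G f)"
proof (induction G arbitrary: H K f g)
  case EmptyOGraph
  then show ?case by (auto simp: fun_eq_iff empty_gset_mor_def empty_gset_def)
next
  case (MkOGraph A r E)
  obtain B q F where H: "H = MkOGraph B q F"
    by (rule ohom_codomain_nonempty[OF MkOGraph.prems(1,4)])
  note G' = MkOGraph.prems(1) and H' = MkOGraph.prems(2)[unfolded H]
    and f = MkOGraph.prems(4)[unfolded H] and g = MkOGraph.prems(5)[unfolded H]
  obtain C s D where K: "K = MkOGraph C s D"
    by (rule ohom_codomain_nonempty[OF H' g])
  note K' = MkOGraph.prems(3)[unfolded K] and g = g[unfolded K]
  have ord: "ordinal (E x y)" "ordinal (F x y)" "ordinal (D x y)" for x y using G' H' K' by auto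
  let ?X = "\<lambda>x. Gamma'_obj pair (E (pre r x) x)"
  let ?gf = "ocomp (MkOGraph A r E) g f"
  have fA: "ob_map f a \<in> B" if "a \<in> A" for a using ohom_ob[OF f] that by simp
  show ?case
    unfolding H Gamma'_mor.simps(2) Gamma'_obj.simps(2)
  proof (rule su_mor_eqI[OF inj])
    fix v assume "v \<in> A"
    then show "Comp GlobCard (su pair ?X A r) (su pair (\<lambda>x. Gamma'_obj pair (F (pre q x) x)) B q) (Gamma'_obj pair K)
        (su_mor pair (\<lambda>x. Gamma'_obj pair (F (pre q x) x)) B q
           (\<lambda>x. Gamma'_mor pair (F (pre q x) x) (edge_mor g (pre q x) x)) (ob_map g))
        (su_mor pair ?X A r (\<lambda>x. Gamma'_mor pair (E (pre r x) x) (edge_mor f (pre r x) x)) (ob_map f)) 0 v =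
        ob_map ?gf v"
      using fA by (simp add: lev_su_0 su_mor_0 ob_map_mor_of)
  next
    fix i x n assume i: "i \<in> non_first A r" and x: "x \<in> lev (?X i) n"
    note fi = ohom_pre[OF G' H' f i]
    note gi = ohom_pre[OF H' K' g fi(1)]
    let ?fi = "edge_mor f (pre r i) i" and ?gi = "edge_mor g (ob_map f (pre r i)) (ob_map f i)"
    have gi': "?gi \<in> ohom (F (ob_map f (pre r i)) (ob_map f i))
        (D (ob_map g (ob_map f (pre r i))) (ob_map g (ob_map f i)))"
      using gi(5) by (simp add: fi(2))
    have "Gamma'_mor pair (E (pre r i) i) (ocomp (E (pre r i) i) ?gi ?fi) = Comp GlobCard (?X i)
        (Gamma'_obj pair (F (ob_map f (pre r i)) (ob_map f i)))
        (Gamma'_obj pair (D (ob_map g (ob_map f (pre r i))) (ob_map g (ob_map f i))))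
        (Gamma'_mor pair (F (ob_map f (pre r i)) (ob_map f i)) ?gi) (Gamma'_mor pair (E (pre r i) i) ?fi)"
      by (rule MkOGraph.IH[of "E (pre r i)" "E (pre r i) i", OF _ _ ord(1) ord(2) ord(3) fi(5) gi']) auto
    moreover have "Gamma'_mor pair (E (pre r i) i) ?fi n x \<in> lev (Gamma'_obj pair (F (ob_map f (pre r i)) (ob_map f i))) n"
      by (rule mor_in[OF Gamma'_mor_in_Hom[OF inj ord(1) ord(2) fi(5)] x])
    ultimately show "Comp GlobCard (su pair ?X A r) (su pair (\<lambda>x. Gamma'_obj pair (F (pre q x) x)) B q) (Gamma'_obj pair K)
        (su_mor pair (\<lambda>x. Gamma'_obj pair (F (pre q x) x)) B q
           (\<lambda>x. Gamma'_mor pair (F (pre q x) x) (edge_mor g (pre q x) x)) (ob_map g))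
        (su_mor pair ?X A r (\<lambda>x. Gamma'_mor pair (E (pre r x) x) (edge_mor f (pre r x) x)) (ob_map f)) (Suc n) (pair (i, x)) =
        pair (ob_map ?gf i, Gamma'_mor pair (E (pre r i) i) (edge_mor ?gf (pre r i) i) n x)"
      using i x fi(1-4) by (simp add: su_mor_Suc inj pair_in_lev_su ob_map_mor_of edge_mor_mor_of)
  qed (auto simp: extensional_def)
qed

lemma is_functor_Gamma':
  assumes inj: "inj pair"
  shows "is_functor OGraph GlobCard (Gamma' pair)"
  unfolding is_functor_def Gamma'_def fnctr.simps
proof (intro conjI ballI is_category_OGraph is_category_GlobCard)
  fix X Y Z :: "'a ograph" and f g
  assume "X \<in> Obj OGraph" "Y \<in> Obj OGraph" "Z \<in> Obj OGraph" "f \<in> Hom OGraph X Y" "g \<in> Hom OGraph Y Z"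
  then show "Gamma'_mor pair X (Comp OGraph X Y Z g f) = Comp GlobCard (Gamma'_obj pair X)
      (Gamma'_obj pair Y) (Gamma'_obj pair Z) (Gamma'_mor pair Y g) (Gamma'_mor pair X f)"
    using Gamma'_mor_ocomp[OF inj] by (simp add: OGraph_Obj OGraph_Hom OGraph_Comp)
next
  fix X :: "'a ograph" assume "X \<in> Obj OGraph"
  then show "Gamma'_mor pair X (Id OGraph X) = Id GlobCard (Gamma'_obj pair X)"
    using Gamma'_mor_oid[OF inj] by (simp add: OGraph_Obj OGraph_Id)
qed (use is_globular_cardinal_Gamma'[OF inj] Gamma'_mor_in_Hom[OF inj] in
    \<open>auto simp: OGraph_Obj OGraph_Hom\<close>)

text \<open>
  The components over consecutive objects can be read off from the values on the summands. Over all
  other pairs of objects the edge-object of \<open>G\<close> is empty and has only one morphism to any graph.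
\<close>

lemma Gamma'_faithful:
  assumes inj: "inj pair"
  shows "ordinal G \<Longrightarrow> ordinal H \<Longrightarrow> f \<in> ohom G H \<Longrightarrow> g \<in> ohom G H \<Longrightarrow>
    Gamma'_mor pair G f = Gamma'_mor pair G g \<Longrightarrow> f = g"
proof (induction G arbitrary: H f g)
  case (MkOGraph A r E)
  obtain B q F where H: "H = MkOGraph B q F"
    by (rule ohom_codomain_nonempty[OF MkOGraph.prems(1,3)])
  note G' = MkOGraph.prems(1) and H' = MkOGraph.prems(2)[unfolded H]
    and f = MkOGraph.prems(3)[unfolded H] and g = MkOGraph.prems(4)[unfolded H]
    and eq = MkOGraph.prems(5)[unfolded Gamma'_mor.simps]
  have ord: "ordinal (E x y)" "ordinal (F x y)" for x y using G' H' by auto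
  let ?X = "\<lambda>x. Gamma'_obj pair (E (pre r x) x)"
  have ob: "ob_map f a = ob_map g a" if "a \<in> A" for a
    using fun_cong[OF fun_cong[OF eq, of 0], of a] that by (simp add: su_mor_0)
  have "edge_mor f x y = edge_mor g x y" if xy: "x \<in> A" "y \<in> A" for x y
  proof (cases "is_succ r x y")
    case True
    then have y: "y \<in> non_first A r" "x = pre r y" using is_succ_iff[of A r] G' by auto
    note fy = ohom_pre(5)[OF G' H' f y(1)] and gy = ohom_pre(5)[OF G' H' g y(1)]
    have gy': "edge_mor g (pre r y) y \<in> ohom (E (pre r y) y) (F (ob_map f (pre r y)) (ob_map f y))"
      using gy ob xy y(2) by simp
    let ?f = "Gamma'_mor pair (E (pre r y) y) (edge_mor f (pre r y) y)"
    let ?g = "Gamma'_mor pair (E (pre r y) y) (edge_mor g (pre r y) y)"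
    have "?f = ?g"
    proof
      fix n
      have "?f n \<in> extensional (lev (?X y) n)" "?g n \<in> extensional (lev (?X y) n)"
        using Gamma'_mor_in_Hom[OF inj ord(1) ord(2) fy] Gamma'_mor_in_Hom[OF inj ord(1) ord(2) gy]
        by (auto simp: Hom_GlobCard_iff PiE_iff)
      then show "?f n = ?g n"
      proof (rule extensionalityI)
        fix v assume v: "v \<in> lev (?X y) n"
        have "pair (ob_map f y, ?f n v) = pair (ob_map g y, ?g n v)"
          using fun_cong[OF fun_cong[OF eq, of "Suc n"], of "pair (y, v)"]
          by (simp add: su_mor_Suc[OF inj y(1), of v "?X"] v)
        then show "?f n v = ?g n v" using inj by (auto dest: injD)
      qed
    qed
    then have "edge_mor f (pre r y) y = edge_mor g (pre r y) y"
      by (rule MkOGraph.IH[of "E (pre r y)" "E (pre r y) y", OF _ _ ord(1) ord(2) fy gy', rotated 2]) auto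
    then show ?thesis using y(2) by simp
  next
    case False
    then have "E x y = EmptyOGraph" using G' by auto
    then show ?thesis using ohom_edge[OF f, of x y] ohom_edge[OF g, of x y] xy by simp
  qed
  then have "mor_of A (ob_map f) (edge_mor f) = mor_of A (ob_map g) (edge_mor g)"
    using ob by (intro mor_of_cong)
  moreover have "f = mor_of A (ob_map f) (edge_mor f)" "g = mor_of A (ob_map g) (edge_mor g)"
    using f g unfolding ohom_Mk_iff by blast+
  ultimately show ?case by simp
qed simp

text \<open>
  Every vertex above level \<open>0\<close> knows its summand, since that is its iterated target. So a morphism
  of suspensions respects summands, and is the suspension of its components.
\<close>

lemma Gamma'_full:
  assumes inj: "inj pair"
  shows "ordinal G \<Longrightarrow> ordinal H \<Longrightarrow> h \<in> Hom GlobCard (Gamma'_obj pair G) (Gamma'_obj pair H) \<Longrightarrow>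
    \<exists>g\<in>ohom G H. Gamma'_mor pair G g = h"
proof (induction G arbitrary: H h)
  case EmptyOGraph
  then have "h = empty_gset_mor"
    by (auto simp: Hom_GlobCard_iff empty_gset_def empty_gset_mor_def fun_eq_iff)
  then show ?case by simp
next
  case (MkOGraph A r E)
  note G' = MkOGraph.prems(1) and h = MkOGraph.prems(3)
  obtain a where "a \<in> A" using G' by auto
  then have "h 0 a \<in> OOb H" using mor_in[OF h, of a 0] by (simp add: lev_su_0 lev_Gamma'_0)
  then obtain B q F where H: "H = MkOGraph B q F" by (cases H) auto
  note H' = MkOGraph.prems(2)[unfolded H] and h = h[unfolded H Gamma'_obj.simps]
  have ord: "ordinal (E x y)" "ordinal (F x y)" for x y using G' H' by auto
  let ?X = "\<lambda>x. Gamma'_obj pair (E (pre r x) x)" and ?Y = "\<lambda>x. Gamma'_obj pair (F (pre q x) x)"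
  interpret X: suspension pair ?X A r
    by (intro ordinal_suspension is_globular_cardinal_Gamma' inj ord G')
  interpret Y: suspension pair ?Y B q
    by (intro ordinal_suspension is_globular_cardinal_Gamma' inj ord H')
  \<comment> \<open>The component of \<open>h\<close> on the summand \<open>i\<close>, obtained by removing the label of the summand.\<close>
  define k where "k i n = restrict (\<lambda>x. snd (inv pair (h (Suc n) (pair (i, x))))) (lev (?X i) n)" for i n
  have hk: "h (Suc n) (pair (i, x)) = pair (h 0 i, k i n x) \<and> h 0 i \<in> non_first B q \<and>
      h 0 (pre r i) = pre q (h 0 i) \<and> k i n x \<in> lev (?Y (h 0 i)) n"
    if i: "i \<in> non_first A r" and x: "x \<in> lev (?X i) n" for i x n
  proof -
    have ix: "pair (i, x) \<in> lev X.S (Suc n)" using i x by (simp add: pair_in_lev_su inj)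
    obtain j y where jy: "h (Suc n) (pair (i, x)) = pair (j, y)" "j \<in> non_first B q" "y \<in> lev (?Y j) n"
      using mor_in[OF h ix] by (rule in_lev_su_SucE)
    have "h 0 i = j" "h 0 (pre r i) = pre q j"
      using mor_base_tgt[OF X.is_globular_set_su h ix] mor_base_src[OF X.is_globular_set_su h ix]
      unfolding jy(1) X.base_su[OF i x] Y.base_su[OF jy(2,3)] by auto
    then show ?thesis using jy x by (simp add: k_def inj)
  qed
  have k_Hom: "k i \<in> Hom GlobCard (?X i) (?Y (h 0 i))" if i: "i \<in> non_first A r" for i
    unfolding Hom_GlobCard_iff
  proof (intro conjI allI ballI)
    show "k i n \<in> lev (?X i) n \<rightarrow>\<^sub>E lev (?Y (h 0 i)) n" for n
      using hk[OF i] by (auto simp: k_def)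
    fix n x assume x: "x \<in> lev (?X i) (Suc n)"
    have X: "is_globular_set (?X i)" by (rule cardinal_globular_set[OF X.card[OF i]])
    note sx = src_in[OF X x] and tx = tgt_in[OF X x]
    have ix: "pair (i, x) \<in> lev X.S (Suc (Suc n))" using i x by (simp add: pair_in_lev_su inj)
    have "pair (h 0 i, k i n (src (?X i) n x)) = pair (h 0 i, src (?Y (h 0 i)) n (k i (Suc n) x))"
      using mor_src[OF h ix] hk[OF i x] hk[OF i sx] i x by (simp add: src_tgt_su inj)
    then show "k i n (src (?X i) n x) = src (?Y (h 0 i)) n (k i (Suc n) x)" using inj by (auto dest: injD)
    have "pair (h 0 i, k i n (tgt (?X i) n x)) = pair (h 0 i, tgt (?Y (h 0 i)) n (k i (Suc n) x))"
      using mor_tgt[OF h ix] hk[OF i x] hk[OF i tx] i x by (simp add: src_tgt_su inj)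
    then show "k i n (tgt (?X i) n x) = tgt (?Y (h 0 i)) n (k i (Suc n) x)" using inj by (auto dest: injD)
  qed
  have h_pre: "h 0 (pre r i) = pre q (h 0 i)" if i: "i \<in> non_first A r" for i
    using X.nonempty[OF i] hk[OF i, of _ 0] by blast
  have "\<exists>g. g \<in> ohom (E (pre r i) i) (F (h 0 (pre r i)) (h 0 i)) \<and>
      Gamma'_mor pair (E (pre r i) i) g = k i" if i: "i \<in> non_first A r" for i
    using MkOGraph.IH[of "E (pre r i)" "E (pre r i) i", OF _ _ ord(1) ord(2) k_Hom[OF i]] h_pre[OF i] by auto
  then obtain g where g: "\<And>i. i \<in> non_first A r \<Longrightarrow> g i \<in> ohom (E (pre r i) i) (F (h 0 (pre r i)) (h 0 i))"
    "\<And>i. i \<in> non_first A r \<Longrightarrow> Gamma'_mor pair (E (pre r i) i) (g i) = k i"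
    by metis
  define g' where "g' = mor_of A (h 0) (\<lambda>x y. if is_succ r x y then g y else EmptyMor)"
  have succ_iff: "is_succ r x y \<longleftrightarrow> y \<in> non_first A r \<and> x = pre r y" for x y
    by (rule is_succ_iff[OF X.lin X.fin])
  have "(if is_succ r x y then g y else EmptyMor) \<in> ohom (E x y) (F (h 0 x) (h 0 y))" for x y
  proof (cases "is_succ r x y")
    case True
    then show ?thesis using g(1) succ_iff by simp
  next
    case False
    then have "E x y = EmptyOGraph" using G' by auto
    with False show ?thesis by simp
  qed
  moreover have "h 0 x \<in> B" if "x \<in> A" for x
    using mor_in[OF h, of x 0] that by (simp add: lev_su_0)
  ultimately have "g' \<in> ohom (MkOGraph A r E) H"
    unfolding H g'_def ohom.simps ograph.sel by blast
  moreover have "Gamma'_mor pair (MkOGraph A r E) g' = h"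
    unfolding Gamma'_mor.simps
  proof (rule su_mor_eqI[OF inj])
    show "h 0 v = ob_map g' v" if "v \<in> A" for v using that by (simp add: g'_def ob_map_mor_of)
    show "h n \<in> extensional (lev X.S n)" for n using h by (auto simp: Hom_GlobCard_iff PiE_iff)
    fix i x n assume i: "i \<in> non_first A r" and x: "x \<in> lev (?X i) n"
    show "h (Suc n) (pair (i, x)) = pair (ob_map g' i,
        Gamma'_mor pair (E (pre r i) i) (edge_mor g' (pre r i) i) n x)"
      using hk[OF i x] g(2)[OF i] X.pre_less[OF i] X.pre_succ[OF i]
      by (simp add: g'_def ob_map_mor_of edge_mor_mor_of)
  qed
  ultimately show ?case by blast
qed

section \<open>The functor from globular cardinals to ordinal graphs\<close>

lemma Gamma_obj_nonempty:
  assumes X: "is_globular_cardinal X" and ne: "lev X 0 \<noteq> {}"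
  shows "Gamma_obj X = MkOGraph (lev X 0) (order0 X)
    (\<lambda>x y. if is_succ (order0 X) x y then Gamma_obj (restr X x y) else EmptyOGraph)"
  by (subst Gamma_obj.simps)
    (simp add: X ne is_succ_iff[OF linear_order_order0[OF X] finite_lev[OF X]])

lemma Gamma_mor_nonempty:
  assumes X: "is_globular_cardinal X" and ne: "lev X 0 \<noteq> {}"
  shows "Gamma_mor X f = MkMor (f 0)
    (\<lambda>x y. if is_succ (order0 X) x y then Gamma_mor (restr X x y) (restr_mor X f x y) else EmptyMor)"
  by (subst Gamma_mor.simps)
    (simp add: X ne is_succ_iff[OF linear_order_order0[OF X] finite_lev[OF X]])

lemma Gamma_empty:
  assumes "lev X 0 = {}"
  shows "Gamma_obj X = EmptyOGraph" "Gamma_mor X f = EmptyMor"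
  using assms by (subst Gamma_obj.simps Gamma_mor.simps; simp)+

lemma ordinal_Gamma_obj: "is_globular_cardinal X \<Longrightarrow> ordinal (Gamma_obj X)"
proof (induction rule: cardinal_induct)
  case (restr X)
  show ?case
  proof (cases "lev X 0 = {}")
    case True
    then show ?thesis by (simp add: Gamma_empty)
  next
    case False
    have "Gamma_obj (restr X y z) \<noteq> EmptyOGraph" if "is_succ (order0 X) y z" for y z
      using Gamma_obj_nonempty[OF is_globular_cardinal_restr[OF restr.hyps(1) that]
          restr_nonempty[OF restr.hyps(1) that]] by simp
    then show ?thesis
      using False restr.IH
      by (auto simp: Gamma_obj_nonempty[OF restr.hyps(1) False] linear_order_order0 finite_lev restr.hyps)
  qed
qed

lemma OOb_Gamma_obj:
  assumes "is_globular_cardinal X" shows "OOb (Gamma_obj X) = lev X 0"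
  using assms by (cases "lev X 0 = {}") (simp_all add: Gamma_empty Gamma_obj_nonempty)

lemma oedge_Gamma_obj:
  assumes "is_globular_cardinal X" "is_succ (order0 X) x y"
  shows "oedge (Gamma_obj X) x y = Gamma_obj (restr X x y)"
proof -
  have "lev X 0 \<noteq> {}" using assms(2) by (auto simp: is_succ_def order0_iff)
  then show ?thesis using assms by (simp add: Gamma_obj_nonempty)
qed

lemma Gamma_mor_in_ohom:
  "is_globular_cardinal X \<Longrightarrow> is_globular_cardinal Y \<Longrightarrow> f \<in> Hom GlobCard X Y \<Longrightarrow>
   Gamma_mor X f \<in> ohom (Gamma_obj X) (Gamma_obj Y)"
proof (induction arbitrary: Y f rule: cardinal_induct)
  case (restr X)
  note X = restr.hyps(1) and Y = restr.prems(1) and f = restr.prems(2)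
  show ?case
  proof (cases "lev X 0 = {}")
    case True
    then show ?thesis by (simp add: Gamma_empty)
  next
    case False
    let ?K = "\<lambda>x y. if is_succ (order0 X) x y then Gamma_mor (restr X x y) (restr_mor X f x y) else EmptyMor"
    have K: "?K x y \<in> ohom (if is_succ (order0 X) x y then Gamma_obj (restr X x y) else EmptyOGraph)
        (oedge (Gamma_obj Y) (f 0 x) (f 0 y))" for x y
    proof (cases "is_succ (order0 X) x y")
      case True
      have s: "is_succ (order0 Y) (f 0 x) (f 0 y)" by (rule mor_is_succ[OF X Y f True])
      show ?thesis
        using restr.IH[OF True is_globular_cardinal_restr[OF Y s] restr_mor_in[OF X Y f True]] True
        by (simp add: oedge_Gamma_obj[OF Y s])
    qed simp
    have "?K x y = EmptyMor" if "\<not> (x \<in> lev X 0 \<and> y \<in> lev X 0)" for x y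
      using that is_succ_field[OF linear_order_order0[OF X], of x y] by auto
    then have mor: "MkMor (f 0) ?K = mor_of (lev X 0) (f 0) ?K"
      using False mor_ext[OF f, of 0] unfolding mor_of_def by (auto simp: fun_eq_iff)
    have "f 0 x \<in> OOb (Gamma_obj Y)" if "x \<in> lev X 0" for x
      using mor_in[OF f that] by (simp add: OOb_Gamma_obj[OF Y])
    then show ?thesis
      unfolding Gamma_obj_nonempty[OF X False] Gamma_mor_nonempty[OF X False] mor ohom.simps
      using K by blast
  qed
qed

section \<open>The unit of the equivalence\<close>

text \<open>
  A cell of level \<open>n + 1\<close> is labelled by its iterated target, which is the summand of \<open>\<Gamma>' (\<Gamma> X)\<close> in
  which it lies, and then regarded as a cell of level \<open>n\<close> of the corresponding restriction. The
  recursion thus follows the level, while the globular cardinal varies.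
\<close>

primrec eta :: "('u \<times> 'u \<Rightarrow> 'u) \<Rightarrow> nat \<Rightarrow> 'u gset \<Rightarrow> 'u \<Rightarrow> 'u" where
  "eta pair 0 = (\<lambda>X x. x)"
| "eta pair (Suc n) = (\<lambda>X x. pair (base_tgt X (Suc n) x,
     eta pair n (restr X (base_src X (Suc n) x) (base_tgt X (Suc n) x)) x))"

text \<open>
  The summand of a cell in the notation of the functors: the restrictions there are indexed by
  \<open>non_first\<close> and \<open>pre\<close>.
\<close>

lemma cell_location:
  assumes X: "is_globular_cardinal X" and x: "x \<in> lev X (Suc n)"
  shows "base_tgt X (Suc n) x \<in> non_first (lev X 0) (order0 X)"
    "base_src X (Suc n) x = pre (order0 X) (base_tgt X (Suc n) x)"
    "x \<in> restr_lev X (pre (order0 X) (base_tgt X (Suc n) x)) (base_tgt X (Suc n) x) n"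
proof -
  note s = is_succ_base[OF X x]
  show 1: "base_tgt X (Suc n) x \<in> non_first (lev X 0) (order0 X)"
    "base_src X (Suc n) x = pre (order0 X) (base_tgt X (Suc n) x)"
    using s is_succ_iff[OF linear_order_order0[OF X] finite_lev[OF X]] by auto
  show "x \<in> restr_lev X (pre (order0 X) (base_tgt X (Suc n) x)) (base_tgt X (Suc n) x) n"
    using restr_lev_eq[OF X s] x unfolding 1(2)[symmetric] by simp
qed

lemma Gamma'_Gamma_nonempty:
  assumes X: "is_globular_cardinal X" and ne: "lev X 0 \<noteq> {}"
  obtains Z where "Gamma'_obj pair (Gamma_obj X) = su pair Z (lev X 0) (order0 X)"
    "\<And>i. i \<in> non_first (lev X 0) (order0 X) \<Longrightarrow>
      Z i = Gamma'_obj pair (Gamma_obj (restr X (pre (order0 X) i) i))"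
proof
  let ?Z = "\<lambda>i. Gamma'_obj pair (if is_succ (order0 X) (pre (order0 X) i) i
      then Gamma_obj (restr X (pre (order0 X) i) i) else EmptyOGraph)"
  show "Gamma'_obj pair (Gamma_obj X) = su pair ?Z (lev X 0) (order0 X)"
    by (simp add: Gamma_obj_nonempty[OF X ne])
  show "?Z i = Gamma'_obj pair (Gamma_obj (restr X (pre (order0 X) i) i))"
    if "i \<in> non_first (lev X 0) (order0 X)" for i
    using is_succ_pre[OF linear_order_order0[OF X] finite_lev[OF X] that] by simp
qed

lemma lev_empty:
  assumes X: "is_globular_set X" and e: "lev X 0 = {}"
  shows "lev X n = {}"
  using base_src_in[OF X, of _ n] e by blast

text \<open>
  The restrictions between consecutive vertices partition each level \<open>n + 1\<close> of \<open>X\<close> according to the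
  iterated target, in the same way as the labels partition the suspension. On each part the claim is
  the induction hypothesis, since the source and the target of a cell of level at least \<open>2\<close> have the
  same iterated target as the cell.
\<close>

lemma eta_bij_and_commutes:
  assumes inj: "inj pair"
  shows "is_globular_cardinal X \<Longrightarrow>
    (\<forall>n. bij_betw (eta pair n X) (lev X n) (lev (Gamma'_obj pair (Gamma_obj X)) n)) \<and>
    (\<forall>n. \<forall>x\<in>lev X (Suc n).
       eta pair n X (src X n x) = src (Gamma'_obj pair (Gamma_obj X)) n (eta pair (Suc n) X x) \<and>
       eta pair n X (tgt X n x) = tgt (Gamma'_obj pair (Gamma_obj X)) n (eta pair (Suc n) X x))"
proof (induction rule: cardinal_induct)
  case (restr X)
  note X = restr.hyps(1)
  have X': "is_globular_set X" by (rule cardinal_globular_set[OF X])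
  show ?case
  proof (cases "lev X 0 = {}")
    case True
    then show ?thesis
      using lev_empty[OF X'] by (simp add: Gamma_empty empty_gset_def bij_betw_def)
  next
    case False
    let ?A = "lev X 0" and ?r = "order0 X"
    let ?R = "\<lambda>i. restr X (pre ?r i) i"
    obtain Z where S: "Gamma'_obj pair (Gamma_obj X) = su pair Z ?A ?r"
      and Z: "\<And>i. i \<in> non_first ?A ?r \<Longrightarrow> Z i = Gamma'_obj pair (Gamma_obj (?R i))"
      using Gamma'_Gamma_nonempty[OF X False, of pair] by blast
    have IH: "bij_betw (eta pair n (?R i)) (restr_lev X (pre ?r i) i n) (lev (Z i) n)"
      "x \<in> restr_lev X (pre ?r i) i (Suc n) \<Longrightarrow>
        eta pair n (?R i) (src X (Suc n) x) = src (Z i) n (eta pair (Suc n) (?R i) x) \<and>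
        eta pair n (?R i) (tgt X (Suc n) x) = tgt (Z i) n (eta pair (Suc n) (?R i) x)"
      if i: "i \<in> non_first ?A ?r" for i n x
      using restr.IH[OF is_succ_pre[OF linear_order_order0[OF X] finite_lev[OF X] i]] Z[OF i]
      by (auto simp: restr_simps simp del: eta.simps)
    have eta_Suc: "eta pair (Suc n) X x = pair (base_tgt X (Suc n) x, eta pair n (?R (base_tgt X (Suc n) x)) x)"
      if "x \<in> lev X (Suc n)" for n x
      using cell_location(2)[OF X that] by simp
    have eta_in: "eta pair n (?R (base_tgt X (Suc n) x)) x \<in> lev (Z (base_tgt X (Suc n) x)) n"
      if "x \<in> lev X (Suc n)" for n x
      using IH(1)[OF cell_location(1)[OF X that]] cell_location(3)[OF X that] by (auto simp: bij_betw_def)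
    have "bij_betw (eta pair n X) (lev X n) (lev (su pair Z ?A ?r) n)" for n
    proof (cases n)
      case 0
      then show ?thesis by (simp add: lev_su_0 bij_betw_def)
    next
      case (Suc m)
      have "inj_on (eta pair (Suc m) X) (lev X (Suc m))"
      proof (rule inj_onI)
        fix x y assume x: "x \<in> lev X (Suc m)" and y: "y \<in> lev X (Suc m)"
          and eq: "eta pair (Suc m) X x = eta pair (Suc m) X y"
        let ?i = "base_tgt X (Suc m) x"
        have i: "base_tgt X (Suc m) y = ?i" and e: "eta pair m (?R ?i) x = eta pair m (?R ?i) y"
          using eq inj unfolding eta_Suc[OF x] eta_Suc[OF y] by (auto dest!: injD simp del: base_tgt.simps)
        show "x = y"
          using IH(1)[OF cell_location(1)[OF X x], of m] e cell_location(3)[OF X x]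
            cell_location(3)[OF X y, unfolded i] by (auto simp: bij_betw_def dest: inj_onD)
      qed
      moreover have "eta pair (Suc m) X ` lev X (Suc m) = lev (su pair Z ?A ?r) (Suc m)"
      proof (intro equalityI subsetI)
        fix v assume "v \<in> eta pair (Suc m) X ` lev X (Suc m)"
        then obtain x where x: "x \<in> lev X (Suc m)" "v = eta pair (Suc m) X x" by blast
        then show "v \<in> lev (su pair Z ?A ?r) (Suc m)"
          using eta_in[OF x(1)] cell_location(1)[OF X x(1)] unfolding x(2) eta_Suc[OF x(1)]
          by (simp add: pair_in_lev_su[OF inj] del: base_tgt.simps)
      next
        fix v assume "v \<in> lev (su pair Z ?A ?r) (Suc m)"
        then obtain i w where v: "v = pair (i, w)" and i: "i \<in> non_first ?A ?r" and w: "w \<in> lev (Z i) m"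
          by (rule in_lev_su_SucE)
        obtain x where x: "x \<in> restr_lev X (pre ?r i) i m" "w = eta pair m (?R i) x"
          using IH(1)[OF i, of m] w by (auto simp: bij_betw_def)
        have "x \<in> lev X (Suc m)" "base_tgt X (Suc m) x = i"
          using x(1) restr_lev_eq[OF X is_succ_pre[OF linear_order_order0[OF X] finite_lev[OF X] i]]
          by auto
        then show "v \<in> eta pair (Suc m) X ` lev X (Suc m)"
          using eta_Suc[of x m] unfolding v x(2) by (metis imageI)
      qed
      ultimately show ?thesis by (simp only: Suc bij_betw_def)
    qed
    moreover have "eta pair n X (src X n x) = src (su pair Z ?A ?r) n (eta pair (Suc n) X x) \<and>
        eta pair n X (tgt X n x) = tgt (su pair Z ?A ?r) n (eta pair (Suc n) X x)"
      if x: "x \<in> lev X (Suc n)" for n x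
    proof -
      let ?i = "base_tgt X (Suc n) x"
      note i = cell_location[OF X x]
      show ?thesis
      proof (cases n)
        case 0
        have "eta pair 0 (?R ?i) x \<in> lev (Z ?i) 0" using eta_in[OF x] by (simp add: 0)
        then show ?thesis
          using 0 i(1,2) unfolding eta_Suc[OF x] by (simp add: src_tgt_su inj)
      next
        case (Suc m)
        note x' = x[unfolded Suc] and i' = i[unfolded Suc]
        have b: "base_tgt X (Suc m) (src X (Suc m) x) = ?i" "base_tgt X (Suc m) (tgt X (Suc m) x) = ?i"
          using base_tgt_src[OF X' x'] by (simp_all add: Suc)
        show ?thesis
          unfolding Suc eta_Suc[OF src_in[OF X' x']] eta_Suc[OF tgt_in[OF X' x']] eta_Suc[OF x'] b
          using IH(2)[OF i(1), of x m] i'(3) eta_in[OF x'] i'(1)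
          by (simp add: src_tgt_su inj Suc del: base_tgt.simps eta.simps)
      qed
    qed
    ultimately show ?thesis unfolding S by blast
  qed
qed

text \<open>
  A morphism commutes with iterated sources and targets, hence with the labels, and its action on the
  rest of a labelled cell is that of its restriction.
\<close>

lemma eta_natural:
  assumes inj: "inj pair"
  shows "is_globular_cardinal X \<Longrightarrow> is_globular_cardinal Y \<Longrightarrow> f \<in> Hom GlobCard X Y \<Longrightarrow> x \<in> lev X n \<Longrightarrow>
    eta pair n Y (f n x) = Gamma'_mor pair (Gamma_obj X) (Gamma_mor X f) n (eta pair n X x)"
proof (induction arbitrary: Y f n x rule: cardinal_induct)
  case (restr X)
  note X = restr.hyps(1) and Y = restr.prems(1) and f = restr.prems(2) and x = restr.prems(3)
  have X': "is_globular_set X" by (rule cardinal_globular_set[OF X])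
  have ne: "lev X 0 \<noteq> {}" using lev_empty[OF X', of n] x by blast
  let ?A = "lev X 0" and ?r = "order0 X"
  show ?case
  proof (cases n)
    case 0
    then show ?thesis
      using x by (simp add: Gamma_obj_nonempty[OF X ne] Gamma_mor_nonempty[OF X ne] su_mor_0)
  next
    case (Suc m)
    note x = x[unfolded Suc]
    let ?i = "base_tgt X (Suc m) x"
    note i = cell_location[OF X x]
    have s: "is_succ ?r (pre ?r ?i) ?i"
      by (rule is_succ_pre[OF linear_order_order0[OF X] finite_lev[OF X] i(1)])
    let ?R = "restr X (pre ?r ?i) ?i"
    have s': "is_succ (order0 Y) (f 0 (pre ?r ?i)) (f 0 ?i)" by (rule mor_is_succ[OF X Y f s])
    have fx: "base_src Y (Suc m) (f (Suc m) x) = f 0 (pre ?r ?i)" "base_tgt Y (Suc m) (f (Suc m) x) = f 0 ?i"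
      using mor_base_src[OF X' f x] mor_base_tgt[OF X' f x] i(2) by simp_all
    have "eta pair (Suc m) Y (f (Suc m) x) =
        pair (f 0 ?i, eta pair m (restr Y (f 0 (pre ?r ?i)) (f 0 ?i)) (restr_mor X f (pre ?r ?i) ?i m x))"
      unfolding eta.simps fx using i(3) by (simp add: restr_mor_def del: base_tgt.simps)
    also have "\<dots> = pair (f 0 ?i, Gamma'_mor pair (Gamma_obj ?R)
        (Gamma_mor ?R (restr_mor X f (pre ?r ?i) ?i)) m (eta pair m ?R x))"
      using restr.IH[OF s is_globular_cardinal_restr[OF Y s'] restr_mor_in[OF X Y f s], of x m] i(3)
      by (simp add: restr_simps del: base_tgt.simps)
    also have "\<dots> = Gamma'_mor pair (Gamma_obj X) (Gamma_mor X f) (Suc m) (pair (?i, eta pair m ?R x))"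
    proof -
      have "eta pair m ?R x \<in> lev (Gamma'_obj pair (Gamma_obj ?R)) m"
        using eta_bij_and_commutes[OF inj is_globular_cardinal_restr[OF X s]] i(3)
        unfolding bij_betw_def restr_simps(1) by blast
      then show ?thesis
        using s by (simp add: Gamma_obj_nonempty[OF X ne] Gamma_mor_nonempty[OF X ne]
            su_mor_Suc[OF inj i(1)] del: base_tgt.simps)
    qed
    also have "pair (?i, eta pair m ?R x) = eta pair (Suc m) X x" using i(2) by simp
    finally show ?thesis by (simp only: Suc)
  qed
qed

lemma eta_natural_iso:
  assumes inj: "inj pair"
  shows "is_natural_iso GlobCard GlobCard id_functor (comp_functor (Gamma' pair) Gamma)
    (\<lambda>X n. restrict (eta pair n X) (lev X n))"
  unfolding is_natural_iso_def id_functor_def comp_functor_def Gamma_def Gamma'_def fnctr.simps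
proof (intro conjI ballI)
  fix X :: "'a gset" assume "X \<in> Obj GlobCard"
  then have X: "is_globular_cardinal X" by simp
  have X': "is_globular_set X" by (rule cardinal_globular_set[OF X])
  let ?e = "\<lambda>n. restrict (eta pair n X) (lev X n)"
  note e = eta_bij_and_commutes[OF inj X]
  have bij: "bij_betw (?e n) (lev X n) (lev (Gamma'_obj pair (Gamma_obj X)) n)" for n
    using e by (subst bij_betw_cong[of _ _ "eta pair n X"]) auto
  show "is_iso GlobCard X (Gamma'_obj pair (Gamma_obj X)) ?e"
  proof (rule is_iso_GlobCardI[OF X' _ bij])
    show "?e \<in> Hom GlobCard X (Gamma'_obj pair (Gamma_obj X))"
      unfolding Hom_GlobCard_iff
      using e src_in[OF X'] tgt_in[OF X'] bij_betwE
      by (fastforce simp del: eta.simps)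
  qed
next
  fix X Y :: "'a gset" and f
  assume "X \<in> Obj GlobCard" "Y \<in> Obj GlobCard" and f: "f \<in> Hom GlobCard X Y"
  then have X: "is_globular_cardinal X" and Y: "is_globular_cardinal Y" by simp_all
  show "Comp GlobCard X Y (Gamma'_obj pair (Gamma_obj Y)) (\<lambda>n. restrict (eta pair n Y) (lev Y n)) f =
      Comp GlobCard X (Gamma'_obj pair (Gamma_obj X)) (Gamma'_obj pair (Gamma_obj Y))
        (Gamma'_mor pair (Gamma_obj X) (Gamma_mor X f)) (\<lambda>n. restrict (eta pair n X) (lev X n))"
    using eta_natural[OF inj X Y f] mor_in[OF f] by (auto simp: fun_eq_iff)
qed

theorem theorem5p13:
  fixes pair :: "'u \<times> 'u \<Rightarrow> 'u"
  assumes "inj pair"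
  shows "is_equivalence_with_inverse
           (GlobCard :: ('u gset, 'u gset_mor) category)
           (OGraph :: ('u ograph, 'u graph_mor) category)
           Gamma (Gamma' pair)"
proof (rule equivalence_if_inverse_fully_faithful[OF is_functor_Gamma'[OF assms] _ _ eta_natural_iso[OF assms]])
  fix X :: "'u gset" assume "X \<in> Obj GlobCard"
  then show "on_obj Gamma X \<in> Obj OGraph" by (simp add: OGraph_Obj Gamma_def ordinal_Gamma_obj)
next
  fix X Y :: "'u gset" and f assume "X \<in> Obj GlobCard" "Y \<in> Obj GlobCard" "f \<in> Hom GlobCard X Y"
  then show "on_mor Gamma X Y f \<in> Hom OGraph (on_obj Gamma X) (on_obj Gamma Y)"
    by (simp add: Gamma_def OGraph_Hom ordinal_Gamma_obj Gamma_mor_in_ohom)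
next
  fix G H :: "'u ograph" and f g
  assume "G \<in> Obj OGraph" "H \<in> Obj OGraph" "f \<in> Hom OGraph G H" "g \<in> Hom OGraph G H"
    "on_mor (Gamma' pair) G H f = on_mor (Gamma' pair) G H g"
  then show "f = g"
    using Gamma'_faithful[OF assms] by (simp add: Gamma'_def OGraph_Obj OGraph_Hom)
next
  fix G H :: "'u ograph" and h
  assume "G \<in> Obj OGraph" "H \<in> Obj OGraph"
    "h \<in> Hom GlobCard (on_obj (Gamma' pair) G) (on_obj (Gamma' pair) H)"
  then show "\<exists>f\<in>Hom OGraph G H. on_mor (Gamma' pair) G H f = h"
    using Gamma'_full[OF assms] by (simp add: Gamma'_def OGraph_Obj OGraph_Hom)
qed

end
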